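(* Let $a_s,b_s,c_s$ satisfy the Lipschitz assumption (L) and let the collocation nodes be the Chebyshev nodes (Ch), both stated in the context. Then there exist $N_0\in\mathbb{N}$ and constants $C,C'$, with $C,C'$ independent of $N$ and $\varphi$, such that for all $N\ge N_0$ and all $\varphi\in\mathcal{C}$ the following holds. Let $y\in\mathcal{C}^{\pm}$ be the solution of $$y'(t)=(G_sy)(t),\ t\in[0,r_s],\qquad y(\theta)=\varphi(\theta),\ \theta\in[-\tau,0].$$ There exists a unique collocation solution $q_N\in\mathcal{C}^{\pm}$ with initial function $\varphi$, and, with $\rho_N:=(I-\mathcal{L}_N^+)y'\in\mathcal{C}^+$ (where $y'$ is taken on $[0,r_s]$), $$\|y-q_N\|_{\mathcal{C}^{\pm}}\le C\|\rho_N\|_{\mathcal{C}^+}\qquad\text{and}\qquad \|y'-q_N'\|_{\mathcal{C}^+}\le C'\|\rho_N\|_{\mathcal{C}^+}.$$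
   Context: Fix $\tau>0$ and reals $r>s\ge 0$, and set $r_s:=r-s$. Let $a,b:[0,\infty)\to\mathbb{C}$ and $c:[0,\infty)\times[-\tau,0]\to\mathbb{C}$ be continuous, and put $a_s(t):=a(s+t)$, $b_s(t):=b(s+t)$, $c_s(t,\theta):=c(s+t,\theta)$ for $t\in[0,r_s]$, $\theta\in[-\tau,0]$. Let $\mathcal{C}:=C([-\tau,0];\mathbb{C})$, $\mathcal{C}^+:=C([0,r_s];\mathbb{C})$, $\mathcal{C}^{\pm}:=C([-\tau,r_s];\mathbb{C})$, each with the maximum norm. The operator $G_s:\mathcal{C}^{\pm}\to\mathcal{C}^+$ is $$(G_sy)(t):=a_s(t)y(t)+b_s(t)y(t-\tau)+\int_{-\tau}^0c_s(t,\theta)y(t+\theta)\,d\theta,\quad t\in[0,r_s].$$ For every $\varphi\in\mathcal{C}$ the initial value problem in the claim has a unique solution $y\in\mathcal{C}^{\pm}$. Assumption (L): $a_s$ and $b_s$ are Lipschitz continuous on $[0,r_s]$ with constants $K_a$, $K_b$; for every $\theta\in[-\tau,0]$, $c_s(\cdot,\theta)$ is Lipschitz continuous on $[0,r_s]$ with constant $K_c(\theta)$, where $K_c\in L^1(-\tau,0)$; and $\theta\mapsto\|c_s(\cdot,\theta)\|_{\mathcal{C}^+}$ belongs to $L^1(-\tau,0)$. Assumption (Ch): for each positive integer $N$ the nodes are $\theta_{N,i}^+:=\frac{r_s}{2}\left(1-\cos\frac{(2i-1)\pi}{2N}\right)$, $i=1,\ldots,N$. $\mathcal{L}_N^+:\mathcal{C}^+\to\mathcal{C}^+$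 is the Lagrange interpolation operator at the nodes $\theta_{N,1}^+,\ldots,\theta_{N,N}^+$ (its values are polynomials of degree at most $N-1$). A collocation solution with initial function $\varphi$ is a function $q_N\in\mathcal{C}^{\pm}$ such that $q_N=\varphi$ on $[-\tau,0]$, the restriction $q_N^+$ of $q_N$ to $[0,r_s]$ is a polynomial of degree at most $N$ with $q_N^+(0)=\varphi(0)$, and $(q_N^+)'(\theta_{N,i}^+)=(G_sq_N)(\theta_{N,i}^+)$ for $i=1,\ldots,N$. In the claim $q_N'$ on $[0,r_s]$ means $(q_N^+)'$. The constants $C,C'$ depend only on $r,s,\tau,a,b,c$. *)

theory Defs
  imports "HOL-Analysis.Analysis" "HOL-Computational_Algebra.Polynomial"
begin

(* C([u,v]; complex). Its elements are extensional, i.e. they take the value "undefined" off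
   [u,v], so that equality in HOL is equality of functions on [u,v]. *)
definition cont_space :: "real \<Rightarrow> real \<Rightarrow> (real \<Rightarrow> complex) set" where
  "cont_space u v = {f \<in> extensional {u..v}. continuous_on {u..v} f}"

definition max_norm :: "real \<Rightarrow> real \<Rightarrow> (real \<Rightarrow> complex) \<Rightarrow> real" where
  "max_norm u v f = (SUP t\<in>{u..v}. norm (f t))"

(* a_s, b_s and, by currying, c_s. *)
definition shift :: "real \<Rightarrow> (real \<Rightarrow> 'a) \<Rightarrow> real \<Rightarrow> 'a" where
  "shift s f = (\<lambda>t. f (s + t))"

(* From here on R is the length r - s of the interval, and a, b, c are the coefficients
   already shifted by s. *)

definition G_op :: "real \<Rightarrow> real \<Rightarrow> (real \<Rightarrow> complex) \<Rightarrow> (real \<Rightarrow> complex) \<Rightarrow>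
    (real \<Rightarrow> real \<Rightarrow> complex) \<Rightarrow> (real \<Rightarrow> complex) \<Rightarrow> real \<Rightarrow> complex" where
  "G_op \<tau> R a b c y = (\<lambda>t\<in>{0..R}.
     a t * y t + b t * y (t - \<tau>) + integral {-\<tau>..0} (\<lambda>\<theta>. c t \<theta> * y (t + \<theta>)))"

(* The derivative of the restriction to [0,R]; one-sided at the two endpoints. *)
definition deriv_plus :: "real \<Rightarrow> (real \<Rightarrow> complex) \<Rightarrow> real \<Rightarrow> complex" where
  "deriv_plus R y = (\<lambda>t\<in>{0..R}. vector_derivative y (at t within {0..R}))"

(* The Lipschitz constants are existentially bound: they are not extra data on which the
   constants of an error estimate could depend. *)
definition lipschitz_assumption :: "real \<Rightarrow> real \<Rightarrow> (real \<Rightarrow> complex) \<Rightarrow>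
    (real \<Rightarrow> complex) \<Rightarrow> (real \<Rightarrow> real \<Rightarrow> complex) \<Rightarrow> bool" where
  "lipschitz_assumption \<tau> R a b c \<longleftrightarrow>
     (\<exists>Ka. Ka-lipschitz_on {0..R} a) \<and>
     (\<exists>Kb. Kb-lipschitz_on {0..R} b) \<and>
     (\<exists>Kc. Kc absolutely_integrable_on {-\<tau><..<0} \<and>
        (\<forall>\<theta>\<in>{-\<tau>..0}. (Kc \<theta>)-lipschitz_on {0..R} (\<lambda>t. c t \<theta>))) \<and>
     (\<lambda>\<theta>. max_norm 0 R (\<lambda>t. c t \<theta>)) absolutely_integrable_on {-\<tau><..<0}"

definition cheb_node :: "real \<Rightarrow> nat \<Rightarrow> nat \<Rightarrow> real" where
  "cheb_node R N i = R / 2 * (1 - cos ((2 * real i - 1) * pi / (2 * real N)))"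

definition lagrange_op :: "real \<Rightarrow> nat \<Rightarrow> (nat \<Rightarrow> real) \<Rightarrow> (real \<Rightarrow> complex) \<Rightarrow> real \<Rightarrow> complex" where
  "lagrange_op R N x f = (\<lambda>t\<in>{0..R}.
     \<Sum>i=1..N. f (x i) * complex_of_real (\<Prod>j\<in>{1..N} - {i}. (t - x j) / (x i - x j)))"

definition ivp_solution :: "real \<Rightarrow> real \<Rightarrow> (real \<Rightarrow> complex) \<Rightarrow> (real \<Rightarrow> complex) \<Rightarrow>
    (real \<Rightarrow> real \<Rightarrow> complex) \<Rightarrow> (real \<Rightarrow> complex) \<Rightarrow> (real \<Rightarrow> complex) \<Rightarrow> bool" where
  "ivp_solution \<tau> R a b c \<phi> y \<longleftrightarrow>
     y \<in> cont_space (-\<tau>) R \<and>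
     (\<forall>t\<in>{0..R}. (y has_vector_derivative G_op \<tau> R a b c y t) (at t within {0..R})) \<and>
     (\<forall>\<theta>\<in>{-\<tau>..0}. y \<theta> = \<phi> \<theta>)"

definition collocation_solution :: "real \<Rightarrow> real \<Rightarrow> (real \<Rightarrow> complex) \<Rightarrow> (real \<Rightarrow> complex) \<Rightarrow>
    (real \<Rightarrow> real \<Rightarrow> complex) \<Rightarrow> nat \<Rightarrow> (nat \<Rightarrow> real) \<Rightarrow> (real \<Rightarrow> complex) \<Rightarrow>
    (real \<Rightarrow> complex) \<Rightarrow> bool" where
  "collocation_solution \<tau> R a b c N x \<phi> q \<longleftrightarrow>
     q \<in> cont_space (-\<tau>) R \<and>
     (\<forall>\<theta>\<in>{-\<tau>..0}. q \<theta> = \<phi> \<theta>) \<and>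
     (\<exists>p :: complex poly. degree p \<le> N \<and> poly p 0 = \<phi> 0 \<and>
        (\<forall>t\<in>{0..R}. q t = poly p (complex_of_real t))) \<and>
     (\<forall>i\<in>{1..N}. deriv_plus R q (x i) = G_op \<tau> R a b c q (x i))"

(* (I - L_N) y' *)
definition interp_residual :: "real \<Rightarrow> nat \<Rightarrow> (nat \<Rightarrow> real) \<Rightarrow> (real \<Rightarrow> complex) \<Rightarrow> real \<Rightarrow> complex" where
  "interp_residual R N x y = (\<lambda>t\<in>{0..R}.
     deriv_plus R y t - lagrange_op R N x (deriv_plus R y) t)"

end

theory Submission
  imports Defs
begin

text \<open>Write \<open>V\<close> for integration from \<open>0\<close>, extended by zero to the
history interval, and \<open>L\<close> for interpolation at the \<open>N\<close> Chebyshev nodes. A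
collocation solution satisfies \<open>q' = L G q\<close>, because \<open>q'\<close> is a polynomial
of degree below \<open>N\<close>. If \<open>y\<close> solves \<open>y' = G y\<close> with the same
history, then \<open>e = y' - q'\<close> satisfies \<open>y - q = V e\<close> and \<open>e = \<rho>
+ L G V e\<close>. Everything follows once \<open>L G V\<close> is a contraction in a suitable norm,
uniformly in all large \<open>N\<close>: stability gives both error bounds
(\<open>collocation_stability\<close>, \<open>collocation_error\<close>), the case \<open>\<rho> =
0\<close> gives uniqueness (\<open>collocation_unique\<close>), and Banach's theorem gives existence
(\<open>collocation_exists\<close>).

The contraction (\<open>eventually_contracts\<close>) holds in the maximum norm with weight
\<open>exp (- \<kappa> t)\<close>. Since \<open>G\<close> is causal, \<open>G V\<close> has norm of
order \<open>1 / \<kappa>\<close> there, so it is small for a large fixed \<open>\<kappa>\<close>.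
What remains is the interpolation error \<open>(L - I) G V\<close>. Here the Lipschitz assumption on
the coefficients enters: \<open>G V\<close> maps bounded functions to Lipschitz functions, with a
constant proportional to the norm (\<open>G_lipschitz\<close>).

Interpolation at Chebyshev nodes approximates Lipschitz functions with an error of order \<open>1 /
sqrt N\<close> (\<open>chebyshev_interpolation_error\<close>), and any rate tending to zero
suffices. Instead of combining Lebesgue constants with best approximation, the proof uses an energy
estimate. In the angle variable the interpolant is a cosine polynomial with frequencies below
\<open>N\<close>. Its increments between neighbouring nodes are those of the interpolated function,
and discrete orthogonality of the sines converts them into a bound on the coefficients, and from
there into a Lipschitz constant of order \<open>sqrt N\<close>
(\<open>cosine_polynomial_oscillation\<close>). Every point lies within distance \<open>\<pi> /
N\<close> of a node, where interpolant and function agree.\<close>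

section \<open>Discrete sine orthogonality and cosine polynomials\<close>

text \<open>Multiplying by twice the sine of half the step makes the sum telescope.\<close>

lemma sum_cos_equispaced:
  assumes "0 < m" and "m < 2 * N"
  shows "(\<Sum>k<N. cos (real k * (real m * pi / real N))) = (1 - (-1) ^ m) / 2"
proof -
  define x where "x = real m * pi / real N"
  have x: "0 < x / 2" "x / 2 < pi" using assms by (auto simp: x_def field_simps)
  have s: "sin (x / 2) > 0" using x by (rule sin_gt_zero)
  have tele: "2 * sin (x / 2) * (\<Sum>k<n. cos (real k * x)) = sin ((real n - 1 / 2) * x) + sin (x / 2)" for n
  proof (induction n)
    case (Suc n)
    have "2 * sin (x / 2) * cos (real n * x) = sin (x / 2 + real n * x) + sin (x / 2 - real n * x)"
      by (simp add: sin_add sin_diff)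
    also have "sin (x / 2 - real n * x) = - sin ((real n - 1 / 2) * x)"
      by (subst sin_minus[symmetric]) (simp add: algebra_simps)
    also have "x / 2 + real n * x = (real (Suc n) - 1 / 2) * x" by (simp add: algebra_simps)
    finally show ?case using Suc by (simp add: algebra_simps)
  qed simp
  have "(real N - 1 / 2) * x = real m * pi - x / 2"
    using assms by (simp add: x_def field_simps)
  then have "2 * sin (x / 2) * (\<Sum>k<N. cos (real k * x)) = (1 - (-1) ^ m) * sin (x / 2)"
    using tele[of N] by (simp add: sin_diff algebra_simps cos_npi mult.commute[of _ pi])
  then have "sin (x / 2) * (2 * (\<Sum>k<N. cos (real k * x))) = sin (x / 2) * (1 - (-1) ^ m)"
    by (simp add: mult_ac)
  then have "2 * (\<Sum>k<N. cos (real k * x)) = 1 - (-1) ^ m" using s by simp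
  then show ?thesis unfolding x_def by simp
qed

lemma sum_sin_sin_equispaced:
  assumes "n \<in> {1..<N}" and "m \<in> {1..<N}"
  shows "(\<Sum>k<N. sin (real n * (real k * pi / real N)) * sin (real m * (real k * pi / real N)))
    = (if n = m then real N / 2 else 0)"
proof -
  have main: "(\<Sum>k<N. sin (real n * (real k * pi / real N)) * sin (real m * (real k * pi / real N)))
    = (if n = m then real N / 2 else 0)" if "m \<le> n" "n < N" "1 \<le> m" for n m :: nat
  proof -
    have "(\<Sum>k<N. sin (real n * (real k * pi / real N)) * sin (real m * (real k * pi / real N)))
      = (\<Sum>k<N. (cos (real k * (real (n - m) * pi / real N)) - cos (real k * (real (n + m) * pi / real N))) / 2)"
    proof (intro sum.cong refl)
      fix k
      have "real k * (real (n - m) * pi / real N) = real n * (real k * pi / real N) - real m * (real k * pi / real N)"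
        "real k * (real (n + m) * pi / real N) = real n * (real k * pi / real N) + real m * (real k * pi / real N)"
        using that by (simp_all add: of_nat_diff algebra_simps diff_divide_distrib add_divide_distrib)
      then show "sin (real n * (real k * pi / real N)) * sin (real m * (real k * pi / real N))
        = (cos (real k * (real (n - m) * pi / real N)) - cos (real k * (real (n + m) * pi / real N))) / 2"
        by (simp only: sin_times_sin)
    qed
    also have "\<dots> = ((\<Sum>k<N. cos (real k * (real (n - m) * pi / real N)))
        - (\<Sum>k<N. cos (real k * (real (n + m) * pi / real N)))) / 2"
      by (simp add: sum_subtractf sum_divide_distrib[symmetric])
    also have "(\<Sum>k<N. cos (real k * (real (n + m) * pi / real N))) = (1 - (-1) ^ (n + m)) / 2"
      using that by (intro sum_cos_equispaced) auto
    also have "(-1 :: real) ^ (n + m) = (-1) ^ (n - m)"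
    proof -
      have "n + m = (n - m) + 2 * m" using that by simp
      then have "(-1 :: real) ^ (n + m) = (-1) ^ ((n - m) + 2 * m)" by (rule arg_cong)
      then show ?thesis by (simp add: power_add power_mult)
    qed
    finally have split: "(\<Sum>k<N. sin (real n * (real k * pi / real N)) * sin (real m * (real k * pi / real N)))
      = ((\<Sum>k<N. cos (real k * (real (n - m) * pi / real N))) - (1 - (-1) ^ (n - m)) / 2) / 2" .
    show ?thesis
    proof (cases "n = m")
      case True
      then show ?thesis using split by simp
    next
      case False
      have low: "(\<Sum>k<N. cos (real k * (real (n - m) * pi / real N))) = (1 - (-1) ^ (n - m)) / 2"
        using that False by (intro sum_cos_equispaced) auto
      show ?thesis unfolding split low using False by simp
    qed
  qed
  show ?thesis
  proof (cases "m \<le> n")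
    case True then show ?thesis using main[of m n] assms by simp
  next
    case False
    then show ?thesis using main[of n m] assms by (simp add: mult.commute)
  qed
qed

text \<open>The vectors of samples \<open>sin (n k \<pi> / N)\<close> for different frequencies
\<open>n\<close> are orthogonal and have square norm \<open>N / 2\<close>. It is applied to
increments of cosine polynomials, whose expansions are sine polynomials.\<close>

lemma discrete_sine_Parseval:
  fixes d :: "nat \<Rightarrow> complex"
  shows "(\<Sum>k<N. (norm (\<Sum>n\<in>{1..<N}. d n * of_real (sin (real n * (real k * pi / real N)))))\<^sup>2)
    = real N / 2 * (\<Sum>n\<in>{1..<N}. (norm (d n))\<^sup>2)"
proof -
  define S where "S n k = complex_of_real (sin (real n * (real k * pi / real N)))" for n k
  have orth: "(\<Sum>k<N. S n k * S m k) = (if m = n then of_real (real N / 2) else 0)"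
    if "n \<in> {1..<N}" "m \<in> {1..<N}" for n m
  proof -
    have "(\<Sum>k<N. S n k * S m k) = of_real (\<Sum>k<N. sin (real n * (real k * pi / real N)) * sin (real m * (real k * pi / real N)))"
      by (simp add: S_def)
    then show ?thesis by (subst (asm) sum_sin_sin_equispaced[OF that]) auto
  qed
  have "complex_of_real (\<Sum>k<N. (norm (\<Sum>n\<in>{1..<N}. d n * S n k))\<^sup>2)
    = (\<Sum>k<N. (\<Sum>n\<in>{1..<N}. d n * S n k) * cnj (\<Sum>n\<in>{1..<N}. d n * S n k))"
    by (simp only: of_real_sum complex_norm_square)
  also have "\<dots> = (\<Sum>k<N. \<Sum>n\<in>{1..<N}. \<Sum>m\<in>{1..<N}. d n * cnj (d m) * (S n k * S m k))"
    by (simp add: S_def sum_product algebra_simps)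
  also have "\<dots> = (\<Sum>n\<in>{1..<N}. \<Sum>k<N. \<Sum>m\<in>{1..<N}. d n * cnj (d m) * (S n k * S m k))"
    by (rule sum.swap)
  also have "\<dots> = (\<Sum>n\<in>{1..<N}. \<Sum>m\<in>{1..<N}. \<Sum>k<N. d n * cnj (d m) * (S n k * S m k))"
    by (intro sum.cong refl sum.swap)
  also have "\<dots> = (\<Sum>n\<in>{1..<N}. \<Sum>m\<in>{1..<N}. if m = n then d n * cnj (d m) * of_real (real N / 2) else 0)"
    by (intro sum.cong refl) (simp add: sum_distrib_left[symmetric] orth)
  also have "\<dots> = (\<Sum>n\<in>{1..<N}. d n * cnj (d n) * of_real (real N / 2))"
    by simp
  also have "\<dots> = of_real (real N / 2 * (\<Sum>n\<in>{1..<N}. (norm (d n))\<^sup>2))"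
    by (simp only: of_real_sum of_real_mult sum_distrib_left complex_norm_square mult_ac)
  finally show ?thesis unfolding S_def of_real_eq_iff .
qed

lemma sin_ge_chord:
  assumes "0 \<le> x" and "x \<le> pi / 2"
  shows "2 * x / pi \<le> sin x"
proof -
  have "convex_on {0..pi / 2} (\<lambda>x. - sin x)"
    by (rule convex_on_realI[where f' = "\<lambda>x. - cos x"])
       (auto intro!: derivative_eq_intros cos_monotone_0_pi_le)
  from convex_onD[OF this, of "2 * x / pi" 0 "pi / 2"] show ?thesis
    using assms pi_gt_zero by (simp add: field_simps)
qed

lemma abs_cos_diff_le: "\<bar>cos x - cos y\<bar> \<le> \<bar>x - y :: real\<bar>"
proof -
  have "\<bar>cos x - cos y\<bar> = 2 * (\<bar>sin ((x + y) / 2)\<bar> * \<bar>sin ((y - x) / 2)\<bar>)"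
    by (simp add: cos_diff_cos abs_mult)
  also have "\<dots> \<le> 2 * (1 * \<bar>(y - x) / 2\<bar>)"
    by (intro mult_left_mono mult_mono abs_sin_le_one abs_sin_x_le_abs_x) auto
  finally show ?thesis by simp
qed

text \<open>Increments between consecutive Chebyshev angles bound the oscillation everywhere. The
increment of \<open>cos (n \<theta>)\<close> over the step centred at \<open>k \<pi> / N\<close> is
\<open>-2 sin (n \<pi> / (2 N)) sin (n k \<pi> / N)\<close>, so the discrete Parseval identity turns
the increments into a weighted square sum of the coefficients. As \<open>sin (n \<pi> / (2 N)) \<ge>
n / N\<close>, this dominates the sum of \<open>n\<^sup>2 \<bar>d n\<bar>\<^sup>2\<close>, and the
Cauchy-Schwarz inequality then bounds the sum of \<open>n \<bar>d n\<bar>\<close>, which is a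
Lipschitz constant of the polynomial. For values of a Lipschitz function \<open>\<delta>\<close> has
order \<open>1 / N\<close>, so that Lipschitz constant has order \<open>sqrt N\<close>.\<close>

lemma cosine_polynomial_oscillation:
  fixes d :: "nat \<Rightarrow> complex" and N :: nat
  defines "P \<equiv> \<lambda>\<theta>. \<Sum>n<N. d n * of_real (cos (real n * \<theta>))"
    and "node \<equiv> \<lambda>k. (2 * real k - 1) * pi / (2 * real N)"
  assumes N: "N \<ge> 1" and \<delta>: "\<And>k. 1 \<le> k \<Longrightarrow> k < N \<Longrightarrow> norm (P (node (Suc k)) - P (node k)) \<le> \<delta>"
    and "\<delta> \<ge> 0"
  shows "norm (P \<theta> - P \<theta>') \<le> \<bar>\<theta> - \<theta>'\<bar> * (real N * sqrt (real N) * \<delta>)"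
proof -
  define e where "e n = d n * of_real (-2 * sin (real n * pi / (2 * real N)))" for n
  have step: "P (node (Suc k)) - P (node k)
      = (\<Sum>n\<in>{1..<N}. e n * of_real (sin (real n * (real k * pi / real N))))" for k
  proof -
    have *: "cos (real n * node (Suc k)) - cos (real n * node k)
      = -2 * sin (real n * pi / (2 * real N)) * sin (real n * (real k * pi / real N))" for n
    proof -
      have "(real n * node (Suc k) + real n * node k) / 2 = real n * (real k * pi / real N)"
        "(real n * node k - real n * node (Suc k)) / 2 = - (real n * pi / (2 * real N))"
        using N by (simp_all add: node_def field_simps)
      then show ?thesis by (simp only: cos_diff_cos sin_minus) simp
    qed
    have "P (node (Suc k)) - P (node k)
      = (\<Sum>n<N. d n * of_real (cos (real n * node (Suc k)) - cos (real n * node k)))"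
      by (simp add: P_def sum_subtractf[symmetric] algebra_simps)
    also have "\<dots> = (\<Sum>n<N. e n * of_real (sin (real n * (real k * pi / real N))))"
      by (simp only: * e_def of_real_mult mult.assoc)
    also have "\<dots> = (\<Sum>n\<in>{1..<N}. e n * of_real (sin (real n * (real k * pi / real N))))"
      by (rule sum.mono_neutral_right) (auto simp: e_def not_le)
    finally show ?thesis .
  qed
  have "real N / 2 * (\<Sum>n\<in>{1..<N}. (norm (e n))\<^sup>2)
    = (\<Sum>k<N. (norm (\<Sum>n\<in>{1..<N}. e n * of_real (sin (real n * (real k * pi / real N)))))\<^sup>2)"
    by (rule discrete_sine_Parseval[symmetric])
  also have "\<dots> \<le> (\<Sum>k<N. \<delta>\<^sup>2)"
  proof (intro sum_mono power_mono)
    fix k assume "k \<in> {..<N}"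
    then show "norm (\<Sum>n\<in>{1..<N}. e n * of_real (sin (real n * (real k * pi / real N)))) \<le> \<delta>"
      using \<delta>[of k] \<open>\<delta> \<ge> 0\<close> by (cases "k = 0") (auto simp: step)
  qed simp
  finally have E: "(\<Sum>n\<in>{1..<N}. (norm (e n))\<^sup>2) \<le> 2 * \<delta>\<^sup>2" using N by simp
  have coef: "real n * norm (d n) \<le> real N * norm (e n) / 2" if "n \<in> {1..<N}" for n
  proof -
    have "2 * (real n * pi / (2 * real N)) / pi \<le> sin (real n * pi / (2 * real N))"
      using that by (intro sin_ge_chord) (auto simp: field_simps)
    then have "real n \<le> real N * \<bar>sin (real n * pi / (2 * real N))\<bar>"
      using N by (simp add: field_simps) (smt (verit) mult_left_mono of_nat_0_le_iff)
    then have "real n * norm (d n) \<le> real N * \<bar>sin (real n * pi / (2 * real N))\<bar> * norm (d n)"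
      by (rule mult_right_mono) simp
    then show ?thesis by (simp add: e_def norm_mult abs_mult algebra_simps)
  qed
  have "(\<Sum>n\<in>{1..<N}. norm (e n)) \<le> L2_set (\<lambda>n. norm (e n)) {1..<N} * L2_set (\<lambda>_. 1) {1..<N}"
    using L2_set_mult_ineq[of "\<lambda>n. norm (e n)" "\<lambda>_. 1" "{1..<N}"] by simp
  also have "\<dots> \<le> sqrt (2 * \<delta>\<^sup>2) * sqrt (real N)"
    unfolding L2_set_def by (intro mult_mono real_sqrt_le_mono E) (auto intro: sum_nonneg)
  also have "\<dots> \<le> (2 * \<delta>) * sqrt (real N)"
    using \<open>\<delta> \<ge> 0\<close> by (intro mult_right_mono real_le_lsqrt) (auto simp: power2_eq_square)
  finally have l1: "(\<Sum>n\<in>{1..<N}. norm (e n)) \<le> 2 * \<delta> * sqrt (real N)" .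
  have "P \<theta> - P \<theta>' = (\<Sum>n<N. d n * of_real (cos (real n * \<theta>) - cos (real n * \<theta>')))"
    by (simp add: P_def sum_subtractf[symmetric] algebra_simps)
  also have "\<dots> = (\<Sum>n\<in>{1..<N}. d n * of_real (cos (real n * \<theta>) - cos (real n * \<theta>')))"
    by (rule sum.mono_neutral_right) (auto simp: not_le)
  also have "norm \<dots> \<le> (\<Sum>n\<in>{1..<N}. \<bar>\<theta> - \<theta>'\<bar> * (real N * norm (e n) / 2))"
  proof (rule sum_norm_le)
    fix n assume n: "n \<in> {1..<N}"
    have "\<bar>cos (real n * \<theta>) - cos (real n * \<theta>')\<bar> \<le> \<bar>real n * \<theta> - real n * \<theta>'\<bar>"
      by (rule abs_cos_diff_le)
    also have "\<dots> = \<bar>\<theta> - \<theta>'\<bar> * real n"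
      by (simp add: right_diff_distrib[symmetric] abs_mult)
    finally have "norm (d n * of_real (cos (real n * \<theta>) - cos (real n * \<theta>'))) \<le> norm (d n) * (\<bar>\<theta> - \<theta>'\<bar> * real n)"
      unfolding norm_mult norm_of_real by (intro mult_left_mono) auto
    also have "\<dots> = \<bar>\<theta> - \<theta>'\<bar> * (real n * norm (d n))" by simp
    also have "\<dots> \<le> \<bar>\<theta> - \<theta>'\<bar> * (real N * norm (e n) / 2)"
      by (intro mult_left_mono coef n) simp
    finally show "norm (d n * of_real (cos (real n * \<theta>) - cos (real n * \<theta>'))) \<le> \<bar>\<theta> - \<theta>'\<bar> * (real N * norm (e n) / 2)" .
  qed
  also have "\<dots> = \<bar>\<theta> - \<theta>'\<bar> * (real N / 2 * (\<Sum>n\<in>{1..<N}. norm (e n)))"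
    by (simp add: sum_distrib_left)
  also have "\<dots> \<le> \<bar>\<theta> - \<theta>'\<bar> * (real N / 2 * (2 * \<delta> * sqrt (real N)))"
    by (intro mult_left_mono l1) auto
  finally show ?thesis by (simp add: algebra_simps)
qed

text \<open>The parameter counts coefficients, so the frequencies are those strictly below
it.\<close>

definition cosine_polynomial :: "nat \<Rightarrow> (real \<Rightarrow> complex) \<Rightarrow> bool" where
  "cosine_polynomial n F \<longleftrightarrow> (\<exists>d. \<forall>\<theta>. F \<theta> = (\<Sum>k<n. d k * of_real (cos (real k * \<theta>))))"

lemma cosine_polynomial_add:
  assumes "cosine_polynomial n F" and "cosine_polynomial n G"
  shows "cosine_polynomial n (\<lambda>\<theta>. F \<theta> + G \<theta>)"
proof -
  obtain d e where "\<forall>\<theta>. F \<theta> = (\<Sum>k<n. d k * of_real (cos (real k * \<theta>)))"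
    "\<forall>\<theta>. G \<theta> = (\<Sum>k<n. e k * of_real (cos (real k * \<theta>)))"
    using assms unfolding cosine_polynomial_def by blast
  then show ?thesis unfolding cosine_polynomial_def
    by (intro exI[of _ "\<lambda>k. d k + e k"]) (simp add: sum.distrib distrib_right)
qed

lemma cosine_polynomial_scale:
  assumes "cosine_polynomial n F"
  shows "cosine_polynomial n (\<lambda>\<theta>. z * F \<theta>)"
proof -
  obtain d where "\<forall>\<theta>. F \<theta> = (\<Sum>k<n. d k * of_real (cos (real k * \<theta>)))"
    using assms unfolding cosine_polynomial_def by blast
  then show ?thesis unfolding cosine_polynomial_def
    by (intro exI[of _ "\<lambda>k. z * d k"]) (simp add: sum_distrib_left mult.assoc)
qed

lemma cosine_polynomial_sum:
  assumes "finite I" and "\<And>i. i \<in> I \<Longrightarrow> cosine_polynomial n (F i)"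
  shows "cosine_polynomial n (\<lambda>\<theta>. \<Sum>i\<in>I. F i \<theta>)"
  using assms
proof (induction I)
  case empty
  show ?case unfolding cosine_polynomial_def by (intro exI[of _ "\<lambda>_. 0"]) simp
next
  case (insert i I)
  then show ?case by (simp add: cosine_polynomial_add)
qed

lemma cosine_polynomial_cos:
  assumes "k < n"
  shows "cosine_polynomial n (\<lambda>\<theta>. of_real (cos (real k * \<theta>)))"
  unfolding cosine_polynomial_def
  using assms by (intro exI[of _ "\<lambda>j. if j = k then 1 else 0"]) (simp add: if_distrib[of "\<lambda>x. x * _"] cong: if_cong)

lemma cosine_polynomial_mult_affine:
  assumes "cosine_polynomial n F"
  shows "cosine_polynomial (Suc n) (\<lambda>\<theta>. of_real (u + v * cos \<theta>) * F \<theta>)"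
proof -
  obtain d where d: "\<forall>\<theta>. F \<theta> = (\<Sum>k<n. d k * of_real (cos (real k * \<theta>)))"
    using assms unfolding cosine_polynomial_def by blast
  have *: "of_real (u + v * cos \<theta>) * F \<theta> = (\<Sum>k<n. (d k * of_real u) * of_real (cos (real k * \<theta>))
      + (d k * of_real v / 2) * (of_real (cos (real (k + 1) * \<theta>)) + of_real (cos (real (if k = 0 then 1 else k - 1) * \<theta>))))" for \<theta>
    unfolding d[rule_format] sum_distrib_left
  proof (rule sum.cong[OF refl])
    fix k :: nat
    \<comment> \<open>the lower neighbour of frequency 0 is \<open>-1\<close>, and \<open>cos (- \<theta>) = cos \<theta>\<close>\<close>
    let ?k' = "if k = 0 then 1 else k - 1"
    have "cos (real k * \<theta>) * cos \<theta> = (cos (real k * \<theta> - \<theta>) + cos (real k * \<theta> + \<theta>)) / 2"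
      by (rule cos_times_cos)
    also have "cos (real k * \<theta> - \<theta>) = cos (real ?k' * \<theta>)"
      by (cases k) (simp_all add: algebra_simps)
    also have "real k * \<theta> + \<theta> = real (k + 1) * \<theta>" by (simp add: algebra_simps)
    finally have "complex_of_real (cos (real k * \<theta>) * cos \<theta>)
      = of_real ((cos (real ?k' * \<theta>) + cos (real (k + 1) * \<theta>)) / 2)" by (rule arg_cong)
    then have prod: "complex_of_real (cos (real k * \<theta>)) * of_real (cos \<theta>)
      = (of_real (cos (real ?k' * \<theta>)) + of_real (cos (real (k + 1) * \<theta>))) / 2"
      by (simp only: of_real_add of_real_mult of_real_divide of_real_numeral)
    have "of_real (u + v * cos \<theta>) * (d k * of_real (cos (real k * \<theta>)))
      = (d k * of_real u) * of_real (cos (real k * \<theta>))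
        + d k * of_real v * (of_real (cos (real k * \<theta>)) * of_real (cos \<theta>))"
      unfolding of_real_add of_real_mult by (simp only: ring_distribs mult_ac)
    then show "of_real (u + v * cos \<theta>) * (d k * of_real (cos (real k * \<theta>))) =
      (d k * of_real u) * of_real (cos (real k * \<theta>))
      + (d k * of_real v / 2) * (of_real (cos (real (k + 1) * \<theta>)) + of_real (cos (real ?k' * \<theta>)))"
      unfolding prod by (simp only: times_divide_eq_right times_divide_eq_left add.commute)
  qed
  show ?thesis unfolding *
    by (intro cosine_polynomial_sum cosine_polynomial_add cosine_polynomial_scale cosine_polynomial_cos) auto
qed


section \<open>Lagrange interpolation at the Chebyshev nodes\<close>

lemma cosine_polynomial_prod_affine:
  assumes "finite A"
  shows "cosine_polynomial (Suc (card A)) (\<lambda>\<theta>. of_real (\<Prod>j\<in>A. u j + v j * cos \<theta>))"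
  using assms
proof (induction A)
  case empty
  show ?case using cosine_polynomial_cos[of 0 1] by simp
next
  case (insert j A)
  have "cosine_polynomial (Suc (Suc (card A)))
      (\<lambda>\<theta>. of_real (u j + v j * cos \<theta>) * of_real (\<Prod>j\<in>A. u j + v j * cos \<theta>))"
    by (rule cosine_polynomial_mult_affine[OF insert.IH])
  then show ?case using insert.hyps by (simp only: prod.insert card_insert_disjoint of_real_mult not_False_eq_True)
qed

lemma obtain_angle:
  assumes "0 < R" and "t \<in> {0..R}"
  obtains \<theta> where "\<theta> \<in> {0..pi}" and "t = R / 2 * (1 - cos \<theta>)"
proof (rule that[of "arccos (1 - 2 * t / R)"])
  have "-1 \<le> 1 - 2 * t / R" "1 - 2 * t / R \<le> 1" using assms by (auto simp: field_simps)
  then show "arccos (1 - 2 * t / R) \<in> {0..pi}" "t = R / 2 * (1 - cos (arccos (1 - 2 * t / R)))"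
    using assms by (auto simp: arccos_lbound arccos_ubound cos_arccos field_simps)
qed

lemma angle_map_range: "0 < (R :: real) \<Longrightarrow> R / 2 * (1 - cos \<theta>) \<in> {0..R}"
proof -
  assume R: "0 < R"
  have "R / 2 * (1 - cos \<theta>) \<le> R / 2 * 2" "0 \<le> R / 2 * (1 - cos \<theta>)"
    using R cos_ge_minus_one[of \<theta>] cos_le_one[of \<theta>] by (intro mult_left_mono mult_nonneg_nonneg; simp)+
  then show ?thesis by simp
qed

text \<open>Each Lagrange basis polynomial is a product of \<open>N - 1\<close> factors that are
affine in \<open>cos \<theta>\<close>, hence a combination of the frequencies below
\<open>N\<close>.\<close>

lemma lagrange_op_cosine_polynomial:
  assumes "0 < R" and "N \<ge> 1"
  shows "\<exists>d. \<forall>\<theta>. lagrange_op R N x f (R / 2 * (1 - cos \<theta>)) = (\<Sum>n<N. d n * of_real (cos (real n * \<theta>)))"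
proof -
  have "cosine_polynomial N (\<lambda>\<theta>. \<Sum>i=1..N. f (x i) *
      of_real (\<Prod>j\<in>{1..N} - {i}. (R / 2 - x j) / (x i - x j) + (- R / 2) / (x i - x j) * cos \<theta>))"
  proof (intro cosine_polynomial_sum cosine_polynomial_scale)
    fix i assume i: "i \<in> {1..N}"
    have card: "Suc (card ({1..N} - {i})) = N" using i assms by simp
    show "cosine_polynomial N (\<lambda>\<theta>. of_real (\<Prod>j\<in>{1..N} - {i}. (R / 2 - x j) / (x i - x j) + (- R / 2) / (x i - x j) * cos \<theta>))"
      using cosine_polynomial_prod_affine[of "{1..N} - {i}" "\<lambda>j. (R / 2 - x j) / (x i - x j)" "\<lambda>j. (- R / 2) / (x i - x j)"]
      unfolding card by simp
  qed simp
  moreover have "lagrange_op R N x f (R / 2 * (1 - cos \<theta>)) = (\<Sum>i=1..N. f (x i) *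
      of_real (\<Prod>j\<in>{1..N} - {i}. (R / 2 - x j) / (x i - x j) + (- R / 2) / (x i - x j) * cos \<theta>))" for \<theta>
  proof -
    have "(R / 2 * (1 - cos \<theta>) - x j) / (x i - x j)
      = (R / 2 - x j) / (x i - x j) + (- R / 2) / (x i - x j) * cos \<theta>" for i j
    proof -
      have "R / 2 * (1 - cos \<theta>) - x j = (R / 2 - x j) + (- R / 2) * cos \<theta>" by (simp add: field_simps)
      then show ?thesis by (simp only: add_divide_distrib times_divide_eq_left)
    qed
    then show ?thesis
      unfolding lagrange_op_def restrict_apply'[OF angle_map_range[OF assms(1)]] by (simp only:)
  qed
  ultimately show ?thesis unfolding cosine_polynomial_def by simp
qed

lemma lagrange_op_node:
  assumes "inj_on x {1..N}" and "i \<in> {1..N}" and "x i \<in> {0..R}"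
  shows "lagrange_op R N x f (x i) = f (x i)"
proof -
  have basis: "(\<Prod>j\<in>{1..N} - {k}. (x i - x j) / (x k - x j)) = (if k = i then 1 else 0)" if "k \<in> {1..N}" for k
  proof (cases "k = i")
    case True
    have "x i \<noteq> x j" if "j \<in> {1..N} - {i}" for j
      using assms(1,2) that by (auto dest: inj_onD)
    then show ?thesis using True by (auto intro!: prod.neutral)
  next
    case False
    then show ?thesis using assms(2) by (auto intro!: prod_zero)
  qed
  have "lagrange_op R N x f (x i) = (\<Sum>k=1..N. if k = i then f (x k) else 0)"
    using assms(3) unfolding lagrange_op_def restrict_apply' [OF assms(3)]
    by (intro sum.cong refl) (simp only: basis of_real_1 of_real_0 mult_1_right mult_zero_right if_distrib split: if_split, simp)
  then show ?thesis using assms(2) by simp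
qed

lemma lagrange_op_poly:
  assumes "N \<ge> 1"
  obtains p :: "complex poly" where "degree p < N"
    and "\<And>t. t \<in> {0..R} \<Longrightarrow> lagrange_op R N x f t = poly p (of_real t)"
proof
  let ?l = "\<lambda>i. \<Prod>j\<in>{1..N} - {i}. [:- of_real (x j / (x i - x j)), of_real (1 / (x i - x j)):] :: complex poly"
  let ?p = "\<Sum>i=1..N. smult (f (x i)) (?l i)"
  have deg: "degree (?l i) \<le> N - 1" if "i \<in> {1..N}" for i
  proof -
    have "degree (?l i) \<le> (\<Sum>j\<in>{1..N} - {i}. degree ([:- of_real (x j / (x i - x j)), of_real (1 / (x i - x j)):] :: complex poly))"
      by (rule degree_prod_sum_le[unfolded o_def]) simp
    also have "\<dots> \<le> (\<Sum>j\<in>{1..N} - {i}. 1)" by (intro sum_mono) (simp add: degree_pCons_le)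
    finally show ?thesis using that by simp
  qed
  have "degree ?p \<le> N - 1"
    by (intro degree_sum_le order.trans[OF degree_smult_le deg]) simp_all
  then show "degree ?p < N" using assms by linarith
  show "lagrange_op R N x f t = poly ?p (of_real t)" if "t \<in> {0..R}" for t
  proof -
    have "poly (?l i) (of_real t) = of_real (\<Prod>j\<in>{1..N} - {i}. (t - x j) / (x i - x j))" for i
      by (simp add: poly_prod diff_divide_distrib)
    then show ?thesis using that by (simp add: lagrange_op_def poly_sum)
  qed
qed

lemma lagrange_op_reproduces_poly:
  fixes p :: "complex poly"
  assumes "degree p < N" and inj: "inj_on x {1..N}" and ran: "x ` {1..N} \<subseteq> {0..R}"
    and f: "\<And>i. i \<in> {1..N} \<Longrightarrow> f (x i) = poly p (of_real (x i))" and t: "t \<in> {0..R}"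
  shows "lagrange_op R N x f t = poly p (of_real t)"
proof -
  obtain q :: "complex poly" where q: "degree q < N"
    "\<And>t. t \<in> {0..R} \<Longrightarrow> lagrange_op R N x f t = poly q (of_real t)"
    using lagrange_op_poly[of N R x f] assms(1) by auto
  let ?A = "(of_real :: real \<Rightarrow> complex) ` x ` {1..N}"
  have card: "card ?A = N"
    unfolding card_image[OF inj_on_subset[OF inj_of_real subset_UNIV]] card_image[OF inj] by simp
  have "q = p"
  proof (rule poly_eqI_degree[of ?A])
    fix z assume "z \<in> ?A"
    then obtain i where i: "i \<in> {1..N}" "z = of_real (x i)" by blast
    then have "x i \<in> {0..R}" using ran by blast
    then show "poly q z = poly p z"
      using q(2)[of "x i"] lagrange_op_node[OF inj i(1)] f[OF i(1)] i(2) by simp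
  qed (use card q(1) assms(1) in auto)
  then show ?thesis using q(2) t by simp
qed

lemma lagrange_op_cong:
  assumes "\<And>i. i \<in> {1..N} \<Longrightarrow> f (x i) = g (x i)"
  shows "lagrange_op R N x f = lagrange_op R N x g"
  using assms unfolding lagrange_op_def by simp

lemma lagrange_op_diff:
  assumes "t \<in> {0..R}"
  shows "lagrange_op R N x (\<lambda>t. f t - g t) t = lagrange_op R N x f t - lagrange_op R N x g t"
  using assms unfolding lagrange_op_def by (simp add: left_diff_distrib sum_subtractf)

definition cheb_angle :: "nat \<Rightarrow> nat \<Rightarrow> real" where
  "cheb_angle N i = (2 * real i - 1) * pi / (2 * real N)"

lemma cheb_node_angle: "cheb_node R N i = R / 2 * (1 - cos (cheb_angle N i))"
  by (simp add: cheb_node_def cheb_angle_def)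

lemma cheb_angle_range: "i \<in> {1..N} \<Longrightarrow> cheb_angle N i \<in> {0..pi}"
proof -
  assume i: "i \<in> {1..N}"
  then have "(2 * real i - 1) * pi \<le> (2 * real N) * pi" "0 \<le> (2 * real i - 1) * pi"
    by (auto intro!: mult_right_mono)
  then show ?thesis using i by (simp add: cheb_angle_def divide_le_eq mult.commute)
qed

lemma cheb_node_range: "0 < R \<Longrightarrow> cheb_node R N i \<in> {0..R}"
  unfolding cheb_node_angle by (rule angle_map_range)

lemma cheb_node_inj:
  assumes "0 < R"
  shows "inj_on (cheb_node R N) {1..N}"
proof (rule inj_onI)
  fix i j assume ij: "i \<in> {1..N}" "j \<in> {1..N}" "cheb_node R N i = cheb_node R N j"
  then have "cos (cheb_angle N i) = cos (cheb_angle N j)"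
    using assms by (simp add: cheb_node_angle)
  then have "cheb_angle N i = cheb_angle N j"
    using cheb_angle_range[OF ij(1)] cheb_angle_range[OF ij(2)] by (auto intro: cos_inj_pi)
  then show "i = j" using ij(1) by (simp add: cheb_angle_def)
qed

lemma obtain_near_cheb_angle:
  assumes "N \<ge> 1" and "\<theta> \<in> {0..pi}"
  obtains k where "k \<in> {1..N}" and "\<bar>\<theta> - cheb_angle N k\<bar> \<le> pi / real N"
proof -
  \<comment> \<open>in units of \<open>\<pi> / N\<close> the Chebyshev angles are the half-integers \<open>k - 1 / 2\<close>\<close>
  define u where "u = real N * \<theta> / pi"
  have u: "0 \<le> u" "u \<le> real N" using assms by (auto simp: u_def field_simps)
  have \<theta>: "\<theta> = u * (pi / real N)" using assms(1) by (simp add: u_def)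
  have dist: "\<bar>\<theta> - cheb_angle N k\<bar> = \<bar>u - (real k - 1 / 2)\<bar> * (pi / real N)" for k
  proof -
    have "\<theta> - cheb_angle N k = (u - (real k - 1 / 2)) * (pi / real N)"
      unfolding \<theta> cheb_angle_def by (simp add: algebra_simps diff_divide_distrib)
    then show ?thesis by (simp add: abs_mult)
  qed
  obtain k where k: "k \<in> {1..N}" "\<bar>u - (real k - 1 / 2)\<bar> \<le> 1"
  proof (cases "u = real N")
    case True
    then show ?thesis using that[of N] assms(1) by simp
  next
    case False
    define j where "j = nat \<lfloor>u\<rfloor>"
    have "real j \<le> u" "u < real j + 1" using u by (auto simp: j_def)
    moreover from this have "j < N" using u False by linarith
    ultimately show ?thesis by (intro that[of "Suc j"]) auto
  qed
  have "\<bar>\<theta> - cheb_angle N k\<bar> \<le> 1 * (pi / real N)"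
    unfolding dist using k(2) by (intro mult_right_mono) auto
  then show ?thesis using that[OF k(1)] by simp
qed

text \<open>In the angle variable the interpolant is a cosine polynomial that agrees with a
Lipschitz function at the Chebyshev angles, so by \<open>cosine_polynomial_oscillation\<close> its
own Lipschitz constant is of order \<open>sqrt N\<close>. Every angle has a Chebyshev angle at
distance at most \<open>\<pi> / N\<close>, and moving there and back costs \<open>sqrt N /
N\<close>. The exponent of this rate is not optimal, but the constant is linear in the Lipschitz
constant and the bound tends to zero.\<close>

lemma chebyshev_interpolation_error:
  assumes R: "0 < R" and N: "N \<ge> 1" and f: "L-lipschitz_on {0..R} f" and t: "t \<in> {0..R}"
  shows "norm (lagrange_op R N (cheb_node R N) f t - f t) \<le> (pi\<^sup>2 + pi) * (R * L / 2) / sqrt (real N)"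
proof -
  define F where "F \<theta> = f (R / 2 * (1 - cos \<theta>))" for \<theta>
  define M where "M = R * L / 2"
  have L: "L \<ge> 0" using f by (rule lipschitz_on_nonneg)
  have M: "M \<ge> 0" using L R by (simp add: M_def)
  have F: "norm (F \<theta> - F \<theta>') \<le> M * \<bar>\<theta> - \<theta>'\<bar>" for \<theta> \<theta>'
  proof -
    have "norm (F \<theta> - F \<theta>') \<le> L * \<bar>R / 2 * (1 - cos \<theta>) - R / 2 * (1 - cos \<theta>')\<bar>"
      using lipschitz_onD[OF f angle_map_range[OF R, of \<theta>] angle_map_range[OF R, of \<theta>']]
      by (simp add: F_def dist_norm)
    also have "\<bar>R / 2 * (1 - cos \<theta>) - R / 2 * (1 - cos \<theta>')\<bar> = R / 2 * \<bar>cos \<theta> - cos \<theta>'\<bar>"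
    proof -
      have "R / 2 * (1 - cos \<theta>) - R / 2 * (1 - cos \<theta>') = R / 2 * (cos \<theta>' - cos \<theta>)"
        by (simp add: field_simps)
      then show ?thesis using R by (simp only: abs_mult) (simp add: abs_minus_commute)
    qed
    also have "L * (R / 2 * \<bar>cos \<theta> - cos \<theta>'\<bar>) \<le> L * (R / 2 * \<bar>\<theta> - \<theta>'\<bar>)"
      using L R by (intro mult_left_mono abs_cos_diff_le) auto
    finally show ?thesis by (simp add: M_def algebra_simps)
  qed
  obtain d where d: "\<And>\<theta>. lagrange_op R N (cheb_node R N) f (R / 2 * (1 - cos \<theta>)) = (\<Sum>n<N. d n * of_real (cos (real n * \<theta>)))"
    using lagrange_op_cosine_polynomial[OF R N] by meson
  let ?P = "\<lambda>\<theta>. \<Sum>n<N. d n * of_real (cos (real n * \<theta>))"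
  have nodes: "?P (cheb_angle N k) = F (cheb_angle N k)" if "k \<in> {1..N}" for k
    using lagrange_op_node[OF cheb_node_inj[OF R] that cheb_node_range[OF R], of f]
    unfolding d[symmetric] F_def cheb_node_angle[symmetric] .
  have osc: "norm (?P \<theta> - ?P \<theta>') \<le> \<bar>\<theta> - \<theta>'\<bar> * (real N * sqrt (real N) * (M * (pi / real N)))" for \<theta> \<theta>'
  proof (rule cosine_polynomial_oscillation[OF N, folded cheb_angle_def])
    fix k assume k: "1 \<le> k" "k < N"
    have "cheb_angle N (Suc k) - cheb_angle N k = pi / real N"
      using N by (simp add: cheb_angle_def field_simps)
    then show "norm (?P (cheb_angle N (Suc k)) - ?P (cheb_angle N k)) \<le> M * (pi / real N)"
      using F[of "cheb_angle N (Suc k)" "cheb_angle N k"] k by (simp add: nodes)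
  qed (use M in simp)
  obtain \<theta> where \<theta>: "\<theta> \<in> {0..pi}" "t = R / 2 * (1 - cos \<theta>)"
    using obtain_angle[OF R t] .
  obtain k where k: "k \<in> {1..N}" "\<bar>\<theta> - cheb_angle N k\<bar> \<le> pi / real N"
    using obtain_near_cheb_angle[OF N \<theta>(1)] .
  have sq: "sqrt (real N) \<ge> 1" using N by auto
  have "lagrange_op R N (cheb_node R N) f t - f t
    = (?P \<theta> - ?P (cheb_angle N k)) - (F \<theta> - F (cheb_angle N k))"
    unfolding \<theta>(2) d nodes[OF k(1)] F_def by simp
  also have "norm \<dots> \<le> norm (?P \<theta> - ?P (cheb_angle N k)) + norm (F \<theta> - F (cheb_angle N k))"
    by (rule norm_triangle_ineq4)
  also have "\<dots> \<le> \<bar>\<theta> - cheb_angle N k\<bar> * (real N * sqrt (real N) * (M * (pi / real N))) + M * \<bar>\<theta> - cheb_angle N k\<bar>"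
    by (intro add_mono osc F)
  also have "\<dots> \<le> pi / real N * (real N * sqrt (real N) * (M * (pi / real N))) + M * (pi / real N)"
    using M k(2) by (intro add_mono mult_right_mono mult_left_mono) auto
  also have "pi / real N * (real N * sqrt (real N) * (M * (pi / real N))) = pi\<^sup>2 * M / sqrt (real N)"
  proof -
    have "sqrt (real N) / real N = 1 / sqrt (real N)" using N by (simp add: frac_eq_eq)
    then have "pi\<^sup>2 * M * (sqrt (real N) / real N) = pi\<^sup>2 * M / sqrt (real N)" by simp
    then show ?thesis using N by (simp add: power2_eq_square mult_ac)
  qed
  also have "M * (pi / real N) \<le> pi * M / sqrt (real N)"
  proof -
    have "sqrt (real N) * 1 \<le> sqrt (real N) * sqrt (real N)" using sq by (intro mult_left_mono) auto
    then have "sqrt (real N) \<le> real N" by simp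
    then have "pi * M / real N \<le> pi * M / sqrt (real N)"
      using M sq by (intro divide_left_mono) auto
    then show ?thesis by (simp add: mult.commute)
  qed
  finally show ?thesis
    by (simp add: M_def add_divide_distrib distrib_right)
qed


section \<open>The Volterra operator\<close>

text \<open>For \<open>t \<le> 0\<close> the interval is empty or a single point, so the integral
vanishes there: a primitive on \<open>[0, R]\<close> extended by zero to the history
interval.\<close>

definition Volterra :: "(real \<Rightarrow> complex) \<Rightarrow> real \<Rightarrow> complex" where
  "Volterra z t = integral {0..t} z"

lemma Volterra_nonpos [simp]: "t \<le> 0 \<Longrightarrow> Volterra z t = 0"
  by (cases "t = 0") (simp_all add: Volterra_def)

lemma Volterra_lipschitz:
  assumes cont: "continuous_on {0..R} z" and bound: "\<And>t. t \<in> {0..R} \<Longrightarrow> norm (z t) \<le> B" and "0 \<le> B"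
  shows "B-lipschitz_on {..R} (Volterra z)"
proof (rule lipschitz_on_leI)
  fix s t :: real assume st: "s \<in> {..R}" "t \<in> {..R}" "s \<le> t"
  let ?s = "max 0 s"
  show "dist (Volterra z s) (Volterra z t) \<le> B * dist s t"
  proof (cases "t \<le> 0")
    case True
    then show ?thesis using st \<open>0 \<le> B\<close> by simp
  next
    case False
    have sub: "{?s..t} \<subseteq> {0..R}" using st by auto
    have split: "Volterra z ?s + integral {?s..t} z = Volterra z t" unfolding Volterra_def
      using st False
      by (intro Henstock_Kurzweil_Integration.integral_combine integrable_continuous_real continuous_on_subset[OF cont]) auto
    have start: "Volterra z ?s = Volterra z s" by (cases "0 \<le> s") (simp_all add: max_def)
    have "Volterra z s - Volterra z t = - integral {?s..t} z"
      unfolding split[symmetric] start by simp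
    then have "dist (Volterra z s) (Volterra z t) = norm (integral {?s..t} z)"
      by (simp only: dist_norm norm_minus_cancel)
    also have "\<dots> \<le> B * (t - ?s)"
      using st False sub by (intro integral_bound continuous_on_subset[OF cont] bound) auto
    also have "\<dots> \<le> B * dist s t"
      using \<open>0 \<le> B\<close> st by (intro mult_left_mono) (auto simp: dist_real_def)
    finally show ?thesis .
  qed
qed fact

lemma Volterra_continuous:
  assumes "continuous_on {0..R} z"
  shows "continuous_on {..R} (Volterra z)"
proof -
  have "compact (z ` {0..R})" using assms by (intro compact_continuous_image) auto
  then obtain B where "B > 0" "\<And>t. t \<in> {0..R} \<Longrightarrow> norm (z t) \<le> B"
    by (auto dest!: compact_imp_bounded simp: bounded_pos)
  then show ?thesis using Volterra_lipschitz[OF assms, of B] by (simp add: lipschitz_on_continuous_on)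
qed

lemma continuous_integrable_upto:
  fixes z :: "real \<Rightarrow> complex"
  assumes "continuous_on {0..R} z" and "t \<le> R"
  shows "z integrable_on {0..t}"
proof (rule integrable_continuous_real)
  have "{0..t} \<subseteq> {0..R}" using assms(2) by simp
  then show "continuous_on {0..t} z" by (rule continuous_on_subset[OF assms(1)])
qed

lemma Volterra_diff:
  assumes "continuous_on {0..R} z" and "continuous_on {0..R} w" and "t \<le> R"
  shows "Volterra (\<lambda>s. z s - w s) t = Volterra z t - Volterra w t"
  unfolding Volterra_def
  by (rule integral_diff[OF continuous_integrable_upto[OF assms(1,3)] continuous_integrable_upto[OF assms(2,3)]])

lemma Volterra_eq_of_derivative:
  assumes "\<And>t. t \<in> {0..R} \<Longrightarrow> (y has_vector_derivative z t) (at t within {0..R})"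
    and "t \<in> {0..R}"
  shows "y t = y 0 + Volterra z t"
proof -
  have "(z has_integral (y t - y 0)) {0..t}"
  proof (rule fundamental_theorem_of_calculus)
    fix s assume "s \<in> {0..t}"
    then have "s \<in> {0..R}" "{0..t} \<subseteq> {0..R}" using assms(2) by auto
    then show "(y has_vector_derivative z s) (at s within {0..t})"
      using assms(1) has_vector_derivative_within_subset by blast
  qed (use assms(2) in simp)
  then show ?thesis unfolding Volterra_def by (simp add: integral_unique)
qed

text \<open>Against the weight \<open>exp (\<kappa> t)\<close> integration gains a factor \<open>1 /
\<kappa>\<close>, which can be made as small as desired.\<close>

lemma Volterra_weighted_bound:
  assumes cont: "continuous_on {0..R} z" and bound: "\<And>t. t \<in> {0..R} \<Longrightarrow> norm (z t) \<le> m * exp (\<kappa> * t)"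
    and "0 < \<kappa>" and "0 \<le> m" and "u \<le> t" and "t \<in> {0..R}"
  shows "norm (Volterra z u) \<le> m * exp (\<kappa> * t) / \<kappa>"
proof (cases "u \<le> 0")
  case True
  then show ?thesis using assms(3,4) by simp
next
  case False
  have int: "((\<lambda>s. m * exp (\<kappa> * s)) has_integral (m / \<kappa> * exp (\<kappa> * u) - m / \<kappa> * exp (\<kappa> * 0))) {0..u}"
  proof (rule fundamental_theorem_of_calculus)
    fix s
    have "((\<lambda>s. m / \<kappa> * exp (\<kappa> * s)) has_real_derivative m / \<kappa> * (exp (\<kappa> * s) * \<kappa>)) (at s within {0..u})"
      by (rule derivative_eq_intros refl)+ simp
    then show "((\<lambda>s. m / \<kappa> * exp (\<kappa> * s)) has_vector_derivative m * exp (\<kappa> * s)) (at s within {0..u})"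
      using \<open>0 < \<kappa>\<close> by (simp add: has_real_derivative_iff_has_vector_derivative)
  qed (use False in simp)
  have "norm (Volterra z u) \<le> integral {0..u} (\<lambda>s. m * exp (\<kappa> * s))"
    unfolding Volterra_def
  proof (rule integral_norm_bound_integral)
    show "z integrable_on {0..u}"
      using assms(5,6) by (intro continuous_integrable_upto[OF cont]) auto
    show "(\<lambda>s. m * exp (\<kappa> * s)) integrable_on {0..u}"
      using int by (rule has_integral_integrable)
    show "norm (z s) \<le> m * exp (\<kappa> * s)" if "s \<in> {0..u}" for s
      using that assms(5,6) by (intro bound) auto
  qed
  also have "\<dots> = m / \<kappa> * exp (\<kappa> * u) - m / \<kappa> * exp (\<kappa> * 0)"
    using int by (rule integral_unique)
  also have "\<dots> \<le> m / \<kappa> * exp (\<kappa> * t)"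
  proof -
    have "exp (\<kappa> * u) \<le> exp (\<kappa> * t)" using assms(3,5) by simp
    then have "m / \<kappa> * exp (\<kappa> * u) \<le> m / \<kappa> * exp (\<kappa> * t)"
      using assms(3,4) by (intro mult_left_mono) simp_all
    moreover have "0 \<le> m / \<kappa> * exp (\<kappa> * 0)" using assms(3,4) by simp
    ultimately show ?thesis by linarith
  qed
  finally show ?thesis by simp
qed

lemma poly_of_real_has_vector_derivative:
  fixes p :: "complex poly"
  shows "((\<lambda>t. poly p (of_real t)) has_vector_derivative poly (pderiv p) (of_real t)) (at t within S)"
proof -
  have "(of_real has_vector_derivative (1 :: complex)) (at t within S)"
    unfolding has_vector_derivative_def by (auto intro!: derivative_eq_intros simp: scaleR_conv_of_real)
  from field_vector_diff_chain_within[OF this has_field_derivative_at_within[OF poly_DERIV]]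
  show ?thesis by (simp add: o_def)
qed

lemma continuous_on_poly_of_real: "continuous_on S (\<lambda>t. poly p (of_real t :: complex))"
  by (intro continuous_intros)

lemma poly_antiderivative:
  fixes p :: "complex poly"
  obtains P where "pderiv P = p" and "poly P 0 = v" and "degree P \<le> Suc (degree p)"
proof
  let ?P = "pCons v (\<Sum>i\<le>degree p. monom (coeff p i / of_nat (Suc i)) i)"
  have coeff: "coeff (\<Sum>i\<le>degree p. monom (coeff p i / of_nat (Suc i)) i) n = coeff p n / of_nat (Suc n)" for n
    by (simp add: coeff_sum if_distrib[of "\<lambda>x. x / _"] coeff_eq_0 cong: if_cong)
  show "pderiv ?P = p"
    by (rule poly_eqI) (simp add: coeff_pderiv coeff del: of_nat_Suc)
  show "poly ?P 0 = v" by simp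
  have "degree (\<Sum>i\<le>degree p. monom (coeff p i / of_nat (Suc i)) i) \<le> degree p"
    by (rule degree_le) (simp add: coeff coeff_eq_0 del: of_nat_Suc)
  then show "degree ?P \<le> Suc (degree p)"
    by (meson degree_pCons_le le_trans Suc_le_mono)
qed

lemma lagrange_op_continuous:
  assumes "N \<ge> 1"
  shows "continuous_on {0..R} (lagrange_op R N x f)"
proof -
  obtain p where "\<And>t. t \<in> {0..R} \<Longrightarrow> lagrange_op R N x f t = poly p (of_real t)"
    using lagrange_op_poly[OF assms] by metis
  then show ?thesis
    using continuous_on_poly_of_real[of "{0..R}" p] by (subst continuous_on_cong[OF refl]) auto
qed

lemma max_norm_upper:
  assumes "continuous_on {u..v} f" and "t \<in> {u..v}"
  shows "norm (f t) \<le> max_norm u v f"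
proof -
  have "compact ((\<lambda>t. norm (f t)) ` {u..v})"
    using assms(1) by (intro compact_continuous_image continuous_intros) auto
  then have "bdd_above ((\<lambda>t. norm (f t)) ` {u..v})"
    by (intro bounded_imp_bdd_above compact_imp_bounded)
  then show ?thesis unfolding max_norm_def using assms(2) by (intro cSUP_upper)
qed

lemma max_norm_least:
  assumes "u \<le> v" and "\<And>t. t \<in> {u..v} \<Longrightarrow> norm (f t) \<le> B"
  shows "max_norm u v f \<le> B"
  unfolding max_norm_def using assms by (intro cSUP_least) auto

section \<open>The delay operator\<close>

text \<open>The coefficients are those already shifted to the initial time, on an interval of length
\<open>R\<close>.\<close>

locale delay_equation =
  fixes \<tau> R :: real and a b :: "real \<Rightarrow> complex" and c :: "real \<Rightarrow> real \<Rightarrow> complex"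
  assumes \<tau>: "0 < \<tau>" and R: "0 < R"
    and cont_a: "continuous_on {0..R} a" and cont_b: "continuous_on {0..R} b"
    and cont_c: "continuous_on ({0..R} \<times> {-\<tau>..0}) (\<lambda>(t, \<theta>). c t \<theta>)"
    and lip: "lipschitz_assumption \<tau> R a b c"
begin

abbreviation G :: "(real \<Rightarrow> complex) \<Rightarrow> real \<Rightarrow> complex" where
  "G \<equiv> G_op \<tau> R a b c"

abbreviation interp :: "nat \<Rightarrow> (real \<Rightarrow> complex) \<Rightarrow> real \<Rightarrow> complex" where
  "interp N \<equiv> lagrange_op R N (cheb_node R N)"

lemma integrand_continuous:
  assumes "continuous_on {-\<tau>..R} y"
  shows "continuous_on ({0..R} \<times> {-\<tau>..0}) (\<lambda>(t, \<theta>). c t \<theta> * y (t + \<theta>))"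
proof -
  have "continuous_on ({0..R} \<times> {-\<tau>..0}) (\<lambda>p. y (fst p + snd p))"
    by (rule continuous_on_compose2[OF assms]) (auto intro!: continuous_intros)
  then show ?thesis using cont_c unfolding split_beta by (rule continuous_on_mult[rotated])
qed

lemma section_continuous:
  assumes "continuous_on ({0..R} \<times> {-\<tau>..0}) (\<lambda>(t, \<theta>). f t \<theta> :: complex)" and "t \<in> {0..R}"
  shows "continuous_on {-\<tau>..0} (f t)"
proof -
  have pair: "continuous_on {-\<tau>..0} (\<lambda>\<theta>. (t, \<theta>))"
    by (rule continuous_on_Pair[OF continuous_on_const continuous_on_id])
  have "(\<lambda>\<theta>. (t, \<theta>)) ` {-\<tau>..0} \<subseteq> {0..R} \<times> {-\<tau>..0}" using assms(2) by auto
  from continuous_on_compose2[OF assms(1) pair this] show ?thesis by simp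
qed

lemma integrand_integrable:
  assumes "continuous_on {-\<tau>..R} y" and "t \<in> {0..R}"
  shows "(\<lambda>\<theta>. c t \<theta> * y (t + \<theta>)) integrable_on {-\<tau>..0}"
  by (rule integrable_continuous_real[OF section_continuous[OF integrand_continuous[OF assms(1)] assms(2)]])

lemma G_continuous:
  assumes "continuous_on {-\<tau>..R} y"
  shows "continuous_on {0..R} (G y)"
proof -
  have "continuous_on {0..R} (\<lambda>t. integral {-\<tau>..0} (\<lambda>\<theta>. c t \<theta> * y (t + \<theta>)))"
    using integral_continuous_on_param[of "{0..R}" "-\<tau>" 0 "\<lambda>t \<theta>. c t \<theta> * y (t + \<theta>)"]
      integrand_continuous[OF assms] by simp
  moreover have "continuous_on {0..R} y" "continuous_on {0..R} (\<lambda>t. y (t - \<tau>))"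
    using \<tau> by (auto intro!: continuous_on_subset[OF assms] continuous_on_compose2[OF assms] continuous_intros)
  ultimately have "continuous_on {0..R} (\<lambda>t. a t * y t + b t * y (t - \<tau>) + integral {-\<tau>..0} (\<lambda>\<theta>. c t \<theta> * y (t + \<theta>)))"
    by (intro continuous_intros cont_a cont_b)
  then show ?thesis by (simp add: G_op_def cong: continuous_on_cong_simp)
qed

lemma G_cong:
  assumes "\<And>u. u \<in> {-\<tau>..R} \<Longrightarrow> y u = z u"
  shows "G y = G z"
proof
  fix t
  have "integral {-\<tau>..0} (\<lambda>\<theta>. c t \<theta> * y (t + \<theta>)) = integral {-\<tau>..0} (\<lambda>\<theta>. c t \<theta> * z (t + \<theta>))"
    if "t \<in> {0..R}" using that by (intro integral_cong) (simp add: assms)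
  then show "G y t = G z t" using assms[of t] assms[of "t - \<tau>"] \<tau> by (simp add: G_op_def restrict_def)
qed

lemma G_diff:
  assumes "continuous_on {-\<tau>..R} y" and "continuous_on {-\<tau>..R} z" and "t \<in> {0..R}"
  shows "G (\<lambda>u. y u - z u) t = G y t - G z t"
  using assms integral_diff[OF integrand_integrable[OF assms(1,3)] integrand_integrable[OF assms(2,3)]]
  by (simp add: G_op_def algebra_simps)

lemma coefficient_bounds:
  obtains A B C where "0 \<le> A" "0 \<le> B" "0 \<le> C"
    and "\<And>t. t \<in> {0..R} \<Longrightarrow> norm (a t) \<le> A" and "\<And>t. t \<in> {0..R} \<Longrightarrow> norm (b t) \<le> B"
    and "\<And>t \<theta>. t \<in> {0..R} \<Longrightarrow> \<theta> \<in> {-\<tau>..0} \<Longrightarrow> norm (c t \<theta>) \<le> C"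
proof -
  have "compact (a ` {0..R})" "compact (b ` {0..R})" "compact ((\<lambda>(t, \<theta>). c t \<theta>) ` ({0..R} \<times> {-\<tau>..0}))"
    by (auto intro!: compact_continuous_image compact_Times cont_a cont_b cont_c)
  then have "bounded (a ` {0..R})" "bounded (b ` {0..R})" "bounded ((\<lambda>(t, \<theta>). c t \<theta>) ` ({0..R} \<times> {-\<tau>..0}))"
    by (simp_all add: compact_imp_bounded)
  then obtain A B C where "0 < A" "0 < B" "0 < C" and *: "\<forall>z\<in>a ` {0..R}. norm z \<le> A" "\<forall>z\<in>b ` {0..R}. norm z \<le> B"
    "\<forall>z\<in>(\<lambda>(t, \<theta>). c t \<theta>) ` ({0..R} \<times> {-\<tau>..0}). norm z \<le> C"
    unfolding bounded_pos by blast
  show ?thesis by (rule that[of A B C]) (use \<open>0 < A\<close> \<open>0 < B\<close> \<open>0 < C\<close> * in auto)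
qed

text \<open>The value at time \<open>t\<close> involves only the past of \<open>t\<close>; this
causality is what lets an increasing weight pass through the operator.\<close>

lemma G_causal_bound:
  obtains M where "0 \<le> M"
    and "\<And>y B t. continuous_on {-\<tau>..R} y \<Longrightarrow> t \<in> {0..R} \<Longrightarrow> (\<And>u. u \<in> {-\<tau>..t} \<Longrightarrow> norm (y u) \<le> B)
      \<Longrightarrow> norm (G y t) \<le> M * B"
proof -
  obtain A B C where ABC: "0 \<le> A" "0 \<le> B" "0 \<le> C"
    and a: "\<And>t. t \<in> {0..R} \<Longrightarrow> norm (a t) \<le> A" and b: "\<And>t. t \<in> {0..R} \<Longrightarrow> norm (b t) \<le> B"
    and c: "\<And>t \<theta>. t \<in> {0..R} \<Longrightarrow> \<theta> \<in> {-\<tau>..0} \<Longrightarrow> norm (c t \<theta>) \<le> C"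
    using coefficient_bounds by metis
  show ?thesis
  proof (rule that[of "A + B + C * \<tau>"])
    show "0 \<le> A + B + C * \<tau>" using ABC \<tau> by simp
    fix y :: "real \<Rightarrow> complex" and D t assume y: "continuous_on {-\<tau>..R} y" and t: "t \<in> {0..R}"
      and D: "\<And>u. u \<in> {-\<tau>..t} \<Longrightarrow> norm (y u) \<le> D"
    have "norm (a t * y t) \<le> A * D" "norm (b t * y (t - \<tau>)) \<le> B * D"
      unfolding norm_mult using t \<tau> ABC by (auto intro!: mult_mono a b D)
    moreover have "norm (integral {-\<tau>..0} (\<lambda>\<theta>. c t \<theta> * y (t + \<theta>))) \<le> (C * D) * (0 - -\<tau>)"
    proof (rule integral_bound)
      show "continuous_on {-\<tau>..0} (\<lambda>\<theta>. c t \<theta> * y (t + \<theta>))"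
        by (rule section_continuous[OF integrand_continuous[OF y] t])
      show "norm (c t \<theta> * y (t + \<theta>)) \<le> C * D" if "\<theta> \<in> {-\<tau>..0}" for \<theta>
        unfolding norm_mult using t that ABC by (intro mult_mono c D) auto
    qed (use \<tau> in simp)
    moreover have "norm (G y t) \<le> norm (a t * y t) + norm (b t * y (t - \<tau>))
        + norm (integral {-\<tau>..0} (\<lambda>\<theta>. c t \<theta> * y (t + \<theta>)))"
      using t by (simp add: G_op_def) (intro norm_triangle_mono order_refl)
    ultimately show "norm (G y t) \<le> (A + B + C * \<tau>) * D" by (simp add: algebra_simps)
  qed
qed

text \<open>Each of the three terms is a product, and an increment of a product splits into one part
where the coefficient varies and one where the function varies. For the distributed delay the first
part is bounded by integrating the Lipschitz constants over the delay.\<close>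

lemma G_lipschitz:
  obtains K where "0 \<le> K"
    and "\<And>y D L. L-lipschitz_on {-\<tau>..R} y \<Longrightarrow> (\<And>u. u \<in> {-\<tau>..R} \<Longrightarrow> norm (y u) \<le> D)
      \<Longrightarrow> (K * (D + L))-lipschitz_on {0..R} (G y)"
proof -
  obtain A B C where ABC: "0 \<le> A" "0 \<le> B" "0 \<le> C"
    and a: "\<And>t. t \<in> {0..R} \<Longrightarrow> norm (a t) \<le> A" and b: "\<And>t. t \<in> {0..R} \<Longrightarrow> norm (b t) \<le> B"
    and c: "\<And>t \<theta>. t \<in> {0..R} \<Longrightarrow> \<theta> \<in> {-\<tau>..0} \<Longrightarrow> norm (c t \<theta>) \<le> C"
    using coefficient_bounds by metis
  obtain Ka Kb Kc where Ka: "Ka-lipschitz_on {0..R} a" and Kb: "Kb-lipschitz_on {0..R} b"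
    and "Kc absolutely_integrable_on {-\<tau><..<0}"
    and Kc: "\<And>\<theta>. \<theta> \<in> {-\<tau>..0} \<Longrightarrow> (Kc \<theta>)-lipschitz_on {0..R} (\<lambda>t. c t \<theta>)"
    using lip unfolding lipschitz_assumption_def by blast
  then have Kc_int: "Kc integrable_on {-\<tau>..0}"
    using absolutely_integrable_on_Icc_iff_Ioo absolutely_integrable_on_def by blast
  define I where "I = integral {-\<tau>..0} Kc"
  have nonneg: "0 \<le> Ka" "0 \<le> Kb" "0 \<le> I"
    using lipschitz_on_nonneg[OF Ka] lipschitz_on_nonneg[OF Kb] lipschitz_on_nonneg[OF Kc]
    by (auto simp: I_def intro!: integral_nonneg Kc_int)
  define K where "K = (Ka + Kb + I) + (A + B + C * \<tau>)"
  show ?thesis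
  proof (rule that[of K])
    show "0 \<le> K" using nonneg ABC \<tau> by (simp add: K_def)
    fix y :: "real \<Rightarrow> complex" and D L assume y: "L-lipschitz_on {-\<tau>..R} y" and D: "\<And>u. u \<in> {-\<tau>..R} \<Longrightarrow> norm (y u) \<le> D"
    have cont: "continuous_on {-\<tau>..R} y" using y by (rule lipschitz_on_continuous_on)
    have L: "0 \<le> L" using y by (rule lipschitz_on_nonneg)
    have D0: "0 \<le> D" using D[of 0] \<tau> R by (auto intro: order_trans[OF norm_ge_zero])
    have product: "norm (f * u - g * v) \<le> norm (f - g) * norm u + norm g * norm (u - v)" for f g u v :: complex
    proof -
      have "f * u - g * v = (f - g) * u + g * (u - v)" by (simp add: algebra_simps)
      then show ?thesis by (metis norm_triangle_ineq norm_mult)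
    qed
    have step: "norm (G y t - G y s) \<le> ((Ka + Kb + I) * D + (A + B + C * \<tau>) * L) * \<bar>t - s\<bar>"
      if t: "t \<in> {0..R}" and s: "s \<in> {0..R}" for t s
    proof -
      have 1: "norm (a t * y t - a s * y s) \<le> (Ka * \<bar>t - s\<bar>) * D + A * (L * \<bar>t - s\<bar>)"
        using t s \<tau> ABC nonneg L
        by (intro order_trans[OF product] add_mono mult_mono a D
              lipschitz_on_normD[OF Ka, unfolded real_norm_def] lipschitz_on_normD[OF y, unfolded real_norm_def]) auto
      have 2: "norm (b t * y (t - \<tau>) - b s * y (s - \<tau>)) \<le> (Kb * \<bar>t - s\<bar>) * D + B * (L * \<bar>t - s\<bar>)"
        using t s \<tau> ABC nonneg L lipschitz_on_normD[OF y, of "t - \<tau>" "s - \<tau>"]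
        by (intro order_trans[OF product] add_mono mult_mono b D
              lipschitz_on_normD[OF Kb, unfolded real_norm_def]) auto
      have "norm (integral {-\<tau>..0} (\<lambda>\<theta>. c t \<theta> * y (t + \<theta>) - c s \<theta> * y (s + \<theta>)))
        \<le> integral {-\<tau>..0} (\<lambda>\<theta>. Kc \<theta> * (\<bar>t - s\<bar> * D) + C * (L * \<bar>t - s\<bar>))"
      proof (rule integral_norm_bound_integral)
        show "(\<lambda>\<theta>. c t \<theta> * y (t + \<theta>) - c s \<theta> * y (s + \<theta>)) integrable_on {-\<tau>..0}"
          by (intro integrable_diff integrand_integrable[OF cont] t s)
        show "(\<lambda>\<theta>. Kc \<theta> * (\<bar>t - s\<bar> * D) + C * (L * \<bar>t - s\<bar>)) integrable_on {-\<tau>..0}"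
          by (intro integrable_add integrable_on_mult_left Kc_int integrable_const_ivl)
        fix \<theta> assume \<theta>: "\<theta> \<in> {-\<tau>..0}"
        have "norm (c t \<theta> * y (t + \<theta>) - c s \<theta> * y (s + \<theta>)) \<le> (Kc \<theta> * \<bar>t - s\<bar>) * D + C * (L * \<bar>t - s\<bar>)"
          using t s \<theta> ABC L lipschitz_on_normD[OF y, of "t + \<theta>" "s + \<theta>"] lipschitz_on_nonneg[OF Kc[OF \<theta>]]
          by (intro order_trans[OF product] add_mono mult_mono c D
                lipschitz_on_normD[OF Kc[OF \<theta>], unfolded real_norm_def]) auto
        then show "norm (c t \<theta> * y (t + \<theta>) - c s \<theta> * y (s + \<theta>)) \<le> Kc \<theta> * (\<bar>t - s\<bar> * D) + C * (L * \<bar>t - s\<bar>)"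
          by (simp add: mult.assoc)
      qed
      also have "\<dots> = I * (\<bar>t - s\<bar> * D) + \<tau> * (C * (L * \<bar>t - s\<bar>))"
        using \<tau> by (subst integral_add) (auto simp: I_def intro!: integrable_on_mult_left Kc_int)
      finally have 3: "norm (integral {-\<tau>..0} (\<lambda>\<theta>. c t \<theta> * y (t + \<theta>)) - integral {-\<tau>..0} (\<lambda>\<theta>. c s \<theta> * y (s + \<theta>)))
        \<le> I * (\<bar>t - s\<bar> * D) + \<tau> * (C * (L * \<bar>t - s\<bar>))"
        unfolding integral_diff[OF integrand_integrable[OF cont t] integrand_integrable[OF cont s]] .
      have "G y t - G y s = (a t * y t - a s * y s) + (b t * y (t - \<tau>) - b s * y (s - \<tau>))
          + (integral {-\<tau>..0} (\<lambda>\<theta>. c t \<theta> * y (t + \<theta>)) - integral {-\<tau>..0} (\<lambda>\<theta>. c s \<theta> * y (s + \<theta>)))"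
        using t s by (simp add: G_op_def)
      also have "norm \<dots> \<le> ((Ka * \<bar>t - s\<bar>) * D + A * (L * \<bar>t - s\<bar>)) + ((Kb * \<bar>t - s\<bar>) * D + B * (L * \<bar>t - s\<bar>))
          + (I * (\<bar>t - s\<bar> * D) + \<tau> * (C * (L * \<bar>t - s\<bar>)))"
        by (intro norm_triangle_mono 1 2 3)
      finally show ?thesis by (simp add: algebra_simps)
    qed
    have "(Ka + Kb + I) * D + (A + B + C * \<tau>) * L \<le> K * (D + L)"
      using ABC nonneg \<tau> L D0 by (simp add: K_def algebra_simps)
    moreover have "((Ka + Kb + I) * D + (A + B + C * \<tau>) * L)-lipschitz_on {0..R} (G y)"
      using step ABC nonneg \<tau> L D0 by (intro lipschitz_onI) (auto simp: dist_norm)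
    ultimately show "(K * (D + L))-lipschitz_on {0..R} (G y)" by (rule lipschitz_on_le[rotated])
  qed
qed

section \<open>The contraction property of the discretised operator\<close>

text \<open>The map \<open>z \<mapsto> interp N (G (Volterra z))\<close> halves the weighted maximum
norm that has weight \<open>exp (- \<kappa> t)\<close>; the norm enters through its upper bounds
\<open>m\<close>.\<close>

definition contracts :: "real \<Rightarrow> nat \<Rightarrow> bool" where
  "contracts \<kappa> N \<longleftrightarrow> (\<forall>z m. continuous_on {0..R} z \<longrightarrow> 0 \<le> m \<longrightarrow>
     (\<forall>t\<in>{0..R}. norm (z t) \<le> m * exp (\<kappa> * t)) \<longrightarrow>
     (\<forall>t\<in>{0..R}. norm (interp N (G (Volterra z)) t) \<le> m / 2 * exp (\<kappa> * t)))"

lemma contractsD: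
  assumes "contracts \<kappa> N" and "continuous_on {0..R} z" and "0 \<le> m"
    and "\<And>t. t \<in> {0..R} \<Longrightarrow> norm (z t) \<le> m * exp (\<kappa> * t)" and "t \<in> {0..R}"
  shows "norm (interp N (G (Volterra z)) t) \<le> m / 2 * exp (\<kappa> * t)"
  using assms unfolding contracts_def by blast

lemma Volterra_continuous_delay:
  assumes "continuous_on {0..R} z"
  shows "continuous_on {-\<tau>..R} (Volterra z)"
  by (rule continuous_on_subset[OF Volterra_continuous[OF assms]]) auto

text \<open>The two halves of the bound have different sources. The Volterra part \<open>G (Volterra
z)\<close> is at most a quarter of the weighted bound as soon as \<open>\<kappa> \<ge> 4 M\<close>.
With \<open>\<kappa>\<close> fixed, \<open>G (Volterra z)\<close> is Lipschitz with a constant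
proportional to the maximum norm of \<open>z\<close>, so its interpolation error is of order
\<open>m / sqrt N\<close>, which is at most a quarter of \<open>m\<close> for large
\<open>N\<close>; the price \<open>exp (\<kappa> R)\<close> for passing from the weighted to the
unweighted norm is part of the constant \<open>Q\<close>.\<close>

lemma eventually_contracts:
  obtains \<kappa> N\<^sub>0 where "0 < \<kappa>" and "1 \<le> N\<^sub>0" and "\<And>N. N\<^sub>0 \<le> N \<Longrightarrow> contracts \<kappa> N"
proof -
  obtain M where M: "0 \<le> M"
    and G_bound: "\<And>y B t. continuous_on {-\<tau>..R} y \<Longrightarrow> t \<in> {0..R} \<Longrightarrow> (\<And>u. u \<in> {-\<tau>..t} \<Longrightarrow> norm (y u) \<le> B)
      \<Longrightarrow> norm (G y t) \<le> M * B"
    using G_causal_bound by metis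
  obtain K where K: "0 \<le> K"
    and G_lip: "\<And>y D L. L-lipschitz_on {-\<tau>..R} y \<Longrightarrow> (\<And>u. u \<in> {-\<tau>..R} \<Longrightarrow> norm (y u) \<le> D)
      \<Longrightarrow> (K * (D + L))-lipschitz_on {0..R} (G y)"
    using G_lipschitz by metis
  define \<kappa> where "\<kappa> = 4 * M + 1"
  have \<kappa>: "0 < \<kappa>" "4 * M \<le> \<kappa>" using M by (auto simp: \<kappa>_def)
  define Q where "Q = (pi\<^sup>2 + pi) * (R * (K * (R * exp (\<kappa> * R) + exp (\<kappa> * R))) / 2)"
  have Q: "0 \<le> Q" using K R by (simp add: Q_def)
  \<comment> \<open>chosen so that \<open>4 Q \<le> sqrt N\<close>; the added one keeps \<open>N\<close> positive\<close>
  define N\<^sub>0 where "N\<^sub>0 = nat \<lceil>(4 * Q)\<^sup>2\<rceil> + 1"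
  have contr: "contracts \<kappa> N" if N: "N\<^sub>0 \<le> N" for N
    unfolding contracts_def
  proof (intro allI impI ballI)
    fix z :: "real \<Rightarrow> complex" and m t
    assume z: "continuous_on {0..R} z" and m: "0 \<le> m"
      and zm: "\<forall>t\<in>{0..R}. norm (z t) \<le> m * exp (\<kappa> * t)" and t: "t \<in> {0..R}"
    define B where "B = m * exp (\<kappa> * R)"
    have B: "0 \<le> B" using m by (simp add: B_def)
    have zB: "norm (z u) \<le> B" if "u \<in> {0..R}" for u
    proof -
      have "m * exp (\<kappa> * u) \<le> B" unfolding B_def using that \<kappa> m by (intro mult_left_mono) auto
      then show ?thesis using zm that by force
    qed
    have V: "continuous_on {-\<tau>..R} (Volterra z)" by (rule Volterra_continuous_delay[OF z])
    have "norm (G (Volterra z) t) \<le> M * (m * exp (\<kappa> * t) / \<kappa>)"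
      using zm \<kappa> m t by (intro G_bound V Volterra_weighted_bound[OF z]) auto
    also have "\<dots> = (M / \<kappa>) * (m * exp (\<kappa> * t))" by simp
    also have "\<dots> \<le> (1 / 4) * (m * exp (\<kappa> * t))"
      using \<kappa> m by (intro mult_right_mono) (auto simp: field_simps)
    finally have volterra_part: "norm (G (Volterra z) t) \<le> (1 / 4) * (m * exp (\<kappa> * t))" .
    have V_lip: "B-lipschitz_on {..R} (Volterra z)"
      by (rule Volterra_lipschitz[OF z zB B])
    have V_bound: "norm (Volterra z u) \<le> R * B" if "u \<in> {-\<tau>..R}" for u
    proof (cases "u \<le> 0")
      case True
      then show ?thesis using R B by simp
    next
      case False
      have "norm (Volterra z u) \<le> B * u"
        using lipschitz_on_normD[OF V_lip, of u 0] that R False by simp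
      also have "\<dots> \<le> B * R" using that B by (intro mult_left_mono) auto
      finally show ?thesis by (simp add: mult.commute)
    qed
    have "(K * (R * B + B))-lipschitz_on {0..R} (G (Volterra z))"
      by (rule G_lip[OF lipschitz_on_subset[OF V_lip] V_bound]) auto
    then have "norm (interp N (G (Volterra z)) t - G (Volterra z) t)
      \<le> (pi\<^sup>2 + pi) * (R * (K * (R * B + B)) / 2) / sqrt (real N)"
      using N N\<^sub>0_def by (intro chebyshev_interpolation_error R t) auto
    also have "\<dots> = Q / sqrt (real N) * m"
      by (simp add: Q_def B_def algebra_simps)
    also have "\<dots> \<le> (1 / 4) * m"
    proof (rule mult_right_mono[OF _ m])
      have "(4 * Q)\<^sup>2 \<le> real N" using N unfolding N\<^sub>0_def by linarith
      then have "4 * Q \<le> sqrt (real N)" by (rule real_le_rsqrt)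
      moreover have "0 < sqrt (real N)" using N N\<^sub>0_def by simp
      ultimately show "Q / sqrt (real N) \<le> 1 / 4" by (simp add: field_simps)
    qed
    also have "\<dots> \<le> (1 / 4) * (m * exp (\<kappa> * t))"
      using m \<kappa> t by (simp add: mult_le_cancel_left1)
    finally have error_part: "norm (interp N (G (Volterra z)) t - G (Volterra z) t) \<le> (1 / 4) * (m * exp (\<kappa> * t))" .
    have "norm (interp N (G (Volterra z)) t)
      \<le> norm (G (Volterra z) t) + norm (interp N (G (Volterra z)) t - G (Volterra z) t)"
      by (rule norm_triangle_sub)
    then show "norm (interp N (G (Volterra z)) t) \<le> m / 2 * exp (\<kappa> * t)"
      using volterra_part error_part by linarith
  qed
  show ?thesis by (rule that[OF \<kappa>(1) _ contr]) (auto simp: N\<^sub>0_def)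
qed

text \<open>The weighted maximum \<open>m\<close> of \<open>z\<close> satisfies \<open>m \<le> m / 2
+ D\<close>.\<close>

lemma contraction_stability:
  assumes "contracts \<kappa> N" and "0 < \<kappa>" and z: "continuous_on {0..R} z"
    and D: "\<And>t. t \<in> {0..R} \<Longrightarrow> norm (z t - interp N (G (Volterra z)) t) \<le> D"
    and t: "t \<in> {0..R}"
  shows "norm (z t) \<le> 2 * exp (\<kappa> * R) * D"
proof -
  have "continuous_on {0..R} (\<lambda>t. norm (z t) * exp (- \<kappa> * t))" by (intro continuous_intros z)
  then obtain t\<^sub>0 where t\<^sub>0: "t\<^sub>0 \<in> {0..R}"
    and max: "\<And>t. t \<in> {0..R} \<Longrightarrow> norm (z t) * exp (- \<kappa> * t) \<le> norm (z t\<^sub>0) * exp (- \<kappa> * t\<^sub>0)"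
    using continuous_attains_sup[of "{0..R}" "\<lambda>t. norm (z t) * exp (- \<kappa> * t)"] R by auto
  define m where "m = norm (z t\<^sub>0) * exp (- \<kappa> * t\<^sub>0)"
  have m: "0 \<le> m" by (simp add: m_def)
  have zm: "norm (z t) \<le> m * exp (\<kappa> * t)" if "t \<in> {0..R}" for t
  proof -
    have "norm (z t) * (exp (- \<kappa> * t) * exp (\<kappa> * t)) \<le> m * exp (\<kappa> * t)"
      using max[OF that] unfolding m_def mult.assoc[symmetric] by (intro mult_right_mono) auto
    then show ?thesis by (simp flip: exp_add)
  qed
  have D0: "0 \<le> D" using D[OF t] by (rule order_trans[OF norm_ge_zero])
  have "norm (z t\<^sub>0) \<le> norm (interp N (G (Volterra z)) t\<^sub>0) + norm (z t\<^sub>0 - interp N (G (Volterra z)) t\<^sub>0)"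
    by (rule norm_triangle_sub)
  also have "\<dots> \<le> m / 2 * exp (\<kappa> * t\<^sub>0) + D"
    by (intro add_mono contractsD[OF assms(1) z m zm t\<^sub>0] D t\<^sub>0)
  finally have "m \<le> (m / 2 * exp (\<kappa> * t\<^sub>0) + D) * exp (- \<kappa> * t\<^sub>0)"
    unfolding m_def by (intro mult_right_mono) auto
  also have "\<dots> = m / 2 + D * exp (- \<kappa> * t\<^sub>0)" by (simp add: algebra_simps flip: exp_add)
  also have "\<dots> \<le> m / 2 + D * 1"
    using D0 \<open>0 < \<kappa>\<close> t\<^sub>0 by (intro add_left_mono mult_left_mono) auto
  finally have "m \<le> 2 * D" by simp
  then have "norm (z t) \<le> (2 * D) * exp (\<kappa> * R)"
    using zm[OF t] D0 \<open>0 < \<kappa>\<close> t by (elim order_trans) (intro mult_mono, auto)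
  then show ?thesis by (simp add: mult_ac)
qed

section \<open>Stability, uniqueness and existence of collocation solutions\<close>

lemma deriv_plus_eq:
  assumes "t \<in> {0..R}" and "(y has_vector_derivative d) (at t within {0..R})"
  shows "deriv_plus R y t = d"
  using assms R by (simp add: deriv_plus_def vector_derivative_within_closed_interval)

text \<open>The derivative is a polynomial of degree below \<open>N\<close>, and such a polynomial
is its own interpolant; the collocation conditions identify the interpolated values.\<close>

lemma collocation_derivative:
  assumes "1 \<le> N" and "collocation_solution \<tau> R a b c N (cheb_node R N) \<phi> q"
  shows "\<And>t. t \<in> {0..R} \<Longrightarrow> (q has_vector_derivative interp N (G q) t) (at t within {0..R})"
    and "\<And>t. t \<in> {0..R} \<Longrightarrow> deriv_plus R q t = interp N (G q) t"
proof -
  obtain p :: "complex poly" where p: "degree p \<le> N" "\<And>t. t \<in> {0..R} \<Longrightarrow> q t = poly p (of_real t)"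
    and node: "\<And>i. i \<in> {1..N} \<Longrightarrow> deriv_plus R q (cheb_node R N i) = G q (cheb_node R N i)"
    using assms(2) unfolding collocation_solution_def by blast
  have der: "(q has_vector_derivative poly (pderiv p) (of_real t)) (at t within {0..R})" if "t \<in> {0..R}" for t
    by (rule has_vector_derivative_transform[OF that _ poly_of_real_has_vector_derivative]) (simp add: p(2))
  have deg: "degree (pderiv p) < N" using p(1) assms(1) by (simp add: degree_pderiv)
  have interp: "interp N (G q) t = poly (pderiv p) (of_real t)" if "t \<in> {0..R}" for t
  proof (rule lagrange_op_reproduces_poly[OF deg cheb_node_inj[OF R] _ _ that])
    show "cheb_node R N ` {1..N} \<subseteq> {0..R}" using cheb_node_range[OF R] by blast
    show "G q (cheb_node R N i) = poly (pderiv p) (of_real (cheb_node R N i))" if "i \<in> {1..N}" for i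
      using node[OF that] deriv_plus_eq[OF cheb_node_range[OF R] der[OF cheb_node_range[OF R]]] by simp
  qed
  show "\<And>t. t \<in> {0..R} \<Longrightarrow> (q has_vector_derivative interp N (G q) t) (at t within {0..R})"
    using der interp by simp
  then show "\<And>t. t \<in> {0..R} \<Longrightarrow> deriv_plus R q t = interp N (G q) t"
    by (intro deriv_plus_eq)
qed

text \<open>The difference \<open>e\<close> of the derivatives satisfies \<open>y - q = Volterra
e\<close> and therefore \<open>e - interp N (G (Volterra e)) = w - interp N (G y)\<close>, so
\<open>contraction_stability\<close> applies. With the exact solution for \<open>y\<close> the
right-hand side is the interpolation residual; with a second collocation solution it vanishes, so
one estimate gives both the error bounds and uniqueness.\<close>

lemma collocation_stability:
  assumes contr: "contracts \<kappa> N" "0 < \<kappa>" and N: "1 \<le> N"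
    and q: "collocation_solution \<tau> R a b c N (cheb_node R N) \<phi> q"
    and y: "continuous_on {-\<tau>..R} y" and init: "\<And>\<theta>. \<theta> \<in> {-\<tau>..0} \<Longrightarrow> y \<theta> = \<phi> \<theta>"
    and der: "\<And>t. t \<in> {0..R} \<Longrightarrow> (y has_vector_derivative w t) (at t within {0..R})"
    and w: "continuous_on {0..R} w"
    and D: "\<And>t. t \<in> {0..R} \<Longrightarrow> norm (w t - interp N (G y) t) \<le> D"
  shows "t \<in> {0..R} \<Longrightarrow> norm (w t - deriv_plus R q t) \<le> 2 * exp (\<kappa> * R) * D"
    and "t \<in> {-\<tau>..R} \<Longrightarrow> norm (y t - q t) \<le> R * (2 * exp (\<kappa> * R)) * D"
proof -
  define e where "e t = w t - interp N (G q) t" for t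
  have q_cont: "continuous_on {-\<tau>..R} q" and q_init: "\<And>\<theta>. \<theta> \<in> {-\<tau>..0} \<Longrightarrow> q \<theta> = \<phi> \<theta>"
    using q unfolding collocation_solution_def cont_space_def by auto
  have e_cont: "continuous_on {0..R} e"
    unfolding e_def by (intro continuous_intros w lagrange_op_continuous N)
  have diff: "y t - q t = Volterra e t" if "t \<in> {-\<tau>..R}" for t
  proof (cases "t \<le> 0")
    case True
    then show ?thesis using that init q_init by simp
  next
    case False
    have "y t - q t = (y 0 - q 0) + Volterra e t"
      using False that
      by (intro Volterra_eq_of_derivative[where R = R and y = "\<lambda>t. y t - q t"])
         (auto simp: e_def intro!: has_vector_derivative_diff der collocation_derivative(1)[OF N q])
    then show ?thesis using init[of 0] q_init[of 0] \<tau> by simp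
  qed
  have residual: "norm (e t - interp N (G (Volterra e)) t) \<le> D" if "t \<in> {0..R}" for t
  proof -
    have "interp N (G (Volterra e)) t = interp N (\<lambda>t. G y t - G q t) t"
    proof (rule arg_cong[where f = "\<lambda>f. f t"], rule lagrange_op_cong)
      fix i
      have "G (Volterra e) = G (\<lambda>t. y t - q t)" by (rule G_cong) (simp add: diff)
      then show "G (Volterra e) (cheb_node R N i) = G y (cheb_node R N i) - G q (cheb_node R N i)"
        by (simp add: G_diff[OF y q_cont cheb_node_range[OF R]])
    qed
    also have "\<dots> = interp N (G y) t - interp N (G q) t" by (rule lagrange_op_diff[OF that])
    finally show ?thesis using D[OF that] by (simp add: e_def)
  qed
  have e_bound: "norm (e t) \<le> 2 * exp (\<kappa> * R) * D" if "t \<in> {0..R}" for t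
    by (rule contraction_stability[OF contr e_cont residual that])
  then show "t \<in> {0..R} \<Longrightarrow> norm (w t - deriv_plus R q t) \<le> 2 * exp (\<kappa> * R) * D"
    by (simp add: e_def collocation_derivative(2)[OF N q])
  have E0: "0 \<le> 2 * exp (\<kappa> * R) * D"
    using R by (intro order_trans[OF norm_ge_zero e_bound[of 0]]) auto
  show "norm (y t - q t) \<le> R * (2 * exp (\<kappa> * R)) * D" if "t \<in> {-\<tau>..R}"
  proof -
    have "norm (y t - q t) = norm (Volterra e t - Volterra e 0)" by (simp add: diff[OF that])
    also have "\<dots> = norm (Volterra e (max 0 t) - Volterra e 0)" by (cases "t \<le> 0") (auto simp: max_def)
    also have "\<dots> \<le> 2 * exp (\<kappa> * R) * D * norm (max 0 t - 0)"
      using that R by (intro lipschitz_on_normD[OF Volterra_lipschitz[OF e_cont e_bound E0]]) auto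
    also have "\<dots> \<le> 2 * exp (\<kappa> * R) * D * R"
      using that R by (intro mult_left_mono[OF _ E0]) auto
    finally show ?thesis by (simp add: mult_ac)
  qed
qed

lemma collocation_unique:
  assumes "contracts \<kappa> N" "0 < \<kappa>" "1 \<le> N"
    and q: "collocation_solution \<tau> R a b c N (cheb_node R N) \<phi> q"
    and q': "collocation_solution \<tau> R a b c N (cheb_node R N) \<phi> q'"
  shows "q' = q"
proof (rule extensionalityI)
  show "q' \<in> extensional {-\<tau>..R}" "q \<in> extensional {-\<tau>..R}"
    using q q' unfolding collocation_solution_def cont_space_def by auto
  fix t assume t: "t \<in> {-\<tau>..R}"
  have "norm (q' t - q t) \<le> R * (2 * exp (\<kappa> * R)) * 0"
  proof (rule collocation_stability(2)[OF assms(1-3) q])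
    show "continuous_on {-\<tau>..R} q'" "\<And>\<theta>. \<theta> \<in> {-\<tau>..0} \<Longrightarrow> q' \<theta> = \<phi> \<theta>"
      using q' unfolding collocation_solution_def cont_space_def by auto
    show "continuous_on {0..R} (interp N (G q'))" by (rule lagrange_op_continuous[OF assms(3)])
  qed (use collocation_derivative(1)[OF assms(3) q'] t in auto)
  then show "q' t = q t" by simp
qed

text \<open>The history is continued by the constant \<open>\<phi> 0\<close>, and the fixed point
plays the role of the derivative. Being an interpolant it is a polynomial of degree below
\<open>N\<close>, so its primitive has the degree that a collocation solution may have.\<close>

lemma collocation_of_fixed_point:
  assumes N: "1 \<le> N" and \<phi>: "continuous_on {-\<tau>..0} \<phi>" and z: "continuous_on {0..R} z"
    and fix_z: "\<And>t. t \<in> {0..R} \<Longrightarrow> z t = interp N (G (\<lambda>u. \<phi> (min u 0) + Volterra z u)) t"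
  shows "collocation_solution \<tau> R a b c N (cheb_node R N) \<phi>
    (restrict (\<lambda>u. \<phi> (min u 0) + Volterra z u) {-\<tau>..R})"
    (is "collocation_solution \<tau> R a b c N _ \<phi> ?q")
proof -
  let ?y = "\<lambda>u. \<phi> (min u 0) + Volterra z u"
  obtain p where p: "degree p < N" "\<And>t. t \<in> {0..R} \<Longrightarrow> interp N (G ?y) t = poly p (of_real t)"
    by (rule lagrange_op_poly[OF N, where R = R and x = "cheb_node R N" and f = "G ?y"]) (rule that)
  obtain P where P: "pderiv P = p" "poly P 0 = \<phi> 0" "degree P \<le> Suc (degree p)"
    by (rule poly_antiderivative)
  have zp: "z t = poly p (of_real t)" if "t \<in> {0..R}" for t
    by (rule trans[OF fix_z[OF that] p(2)[OF that]])
  have der: "((\<lambda>t. poly P (of_real t)) has_vector_derivative z t) (at t within {0..R})" if "t \<in> {0..R}" for t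
    using poly_of_real_has_vector_derivative[of P t "{0..R}"] unfolding P(1) zp[OF that] .
  have qP: "?q t = poly P (of_real t)" if "t \<in> {0..R}" for t
    using Volterra_eq_of_derivative[OF der that] that \<tau> P(2) by simp
  have qder: "(?q has_vector_derivative z t) (at t within {0..R})" if "t \<in> {0..R}" for t
    by (rule has_vector_derivative_transform[OF that _ der[OF that]]) (simp only: qP)
  have Gq: "G ?q = G ?y" by (rule G_cong) simp
  have node: "deriv_plus R ?q (cheb_node R N i) = G ?q (cheb_node R N i)" if "i \<in> {1..N}" for i
    unfolding Gq deriv_plus_eq[OF cheb_node_range[OF R] qder[OF cheb_node_range[OF R]]] fix_z[OF cheb_node_range[OF R]]
    by (rule lagrange_op_node[OF cheb_node_inj[OF R] that cheb_node_range[OF R]])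
  have "continuous_on {-\<tau>..R} ?y"
    using \<tau> by (intro continuous_intros Volterra_continuous_delay[OF z] continuous_on_compose2[OF \<phi>]) auto
  then have "?q \<in> cont_space (-\<tau>) R" by (simp add: cont_space_def cong: continuous_on_cong_simp)
  moreover have "degree P \<le> N" using P(3) p(1) by linarith
  ultimately show ?thesis
    unfolding collocation_solution_def using node qP P(2) R by (auto intro!: exI[of _ P])
qed

text \<open>The fixed point comes from Banach's theorem in the space of bounded continuous functions
on the line. The weight is moved into the unknown: \<open>v\<close> stands for \<open>exp (-
\<kappa> t) z t\<close>, so that the unweighted norm of \<open>v\<close> is the norm in which the
map contracts, and arguments are clamped to \<open>[0, R]\<close> to extend functions to the whole
line.\<close>

lemma collocation_exists:
  assumes contr: "contracts \<kappa> N" and N: "1 \<le> N" and \<phi>: "continuous_on {-\<tau>..0} \<phi>"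
  shows "\<exists>q. collocation_solution \<tau> R a b c N (cheb_node R N) \<phi> q"
proof -
  define unweight :: "(real \<Rightarrow>\<^sub>C complex) \<Rightarrow> real \<Rightarrow> complex"
    where "unweight v t = of_real (exp (\<kappa> * t)) * v t" for v t
  define Y where "Y v u = \<phi> (min u 0) + Volterra (unweight v) u" for v u
  define cl where "cl t = max 0 (min R t)" for t :: real
  define S0 where "S0 v t = of_real (exp (- \<kappa> * cl t)) * interp N (G (Y v)) (cl t)" for v t
  define S where "S v = Bcontfun (S0 v)" for v
  have cl: "cl t \<in> {0..R}" for t using R by (simp add: cl_def)
  have u_cont: "continuous_on A (unweight v)" for A v
    unfolding unweight_def by (intro continuous_intros) auto
  have Y_cont: "continuous_on {-\<tau>..R} (Y v)" for v
    unfolding Y_def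
    using \<tau> by (intro continuous_intros Volterra_continuous_delay[OF u_cont] continuous_on_compose2[OF \<phi>]) auto
  have S0: "S0 v \<in> bcontfun" for v
  proof -
    have cont: "continuous_on {0..R} (\<lambda>t. of_real (exp (- \<kappa> * t)) * interp N (G (Y v)) t)"
      by (intro continuous_intros lagrange_op_continuous N)
    have cl_cont: "continuous_on UNIV cl" unfolding cl_def by (intro continuous_intros)
    have "range cl \<subseteq> {0..R}" using cl by blast
    then have "continuous_on UNIV (S0 v)"
      unfolding S0_def by (rule continuous_on_compose2[OF cont cl_cont])
    moreover have "range (S0 v) \<subseteq> (\<lambda>t. of_real (exp (- \<kappa> * t)) * interp N (G (Y v)) t) ` {0..R}"
      unfolding S0_def using cl by blast
    then have "bounded (range (S0 v))"
      using compact_imp_bounded[OF compact_continuous_image[OF cont compact_Icc]] bounded_subset by blast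
    ultimately show ?thesis by (simp add: bcontfun_def)
  qed
  then have S: "apply_bcontfun (S v) = S0 v" for v
    unfolding S_def by (rule Bcontfun_inverse)
  have lin: "interp N (G (Y v)) t - interp N (G (Y w)) t
    = interp N (G (Volterra (\<lambda>s. unweight v s - unweight w s))) t" if "t \<in> {0..R}" for v w t
  proof -
    have "interp N (\<lambda>t. G (Y v) t - G (Y w) t) = interp N (G (Volterra (\<lambda>s. unweight v s - unweight w s)))"
    proof (rule lagrange_op_cong)
      fix i
      have "G (\<lambda>u. Y v u - Y w u) = G (Volterra (\<lambda>s. unweight v s - unweight w s))"
        by (rule G_cong) (simp add: Y_def Volterra_diff[OF u_cont[of "{0..R}"] u_cont[of "{0..R}"]])
      then show "G (Y v) (cheb_node R N i) - G (Y w) (cheb_node R N i)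
        = G (Volterra (\<lambda>s. unweight v s - unweight w s)) (cheb_node R N i)"
        by (metis G_diff[OF Y_cont Y_cont cheb_node_range[OF R]])
    qed
    then show ?thesis using lagrange_op_diff[OF that] by metis
  qed
  have "dist (S v) (S w) \<le> 1 / 2 * dist v w" for v w
  proof (rule dist_bound)
    fix t
    have "norm (interp N (G (Volterra (\<lambda>s. unweight v s - unweight w s))) (cl t)) \<le> dist v w / 2 * exp (\<kappa> * cl t)"
    proof (rule contractsD[OF contr _ _ _ cl])
      show "continuous_on {0..R} (\<lambda>s. unweight v s - unweight w s)" by (intro continuous_intros u_cont)
      fix s
      have "norm (unweight v s - unweight w s) = dist (v s) (w s) * exp (\<kappa> * s)"
        by (simp add: unweight_def dist_norm norm_mult flip: right_diff_distrib)
      also have "\<dots> \<le> dist v w * exp (\<kappa> * s)" by (intro mult_right_mono dist_bounded) auto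
      finally show "norm (unweight v s - unweight w s) \<le> dist v w * exp (\<kappa> * s)" .
    qed auto
    moreover have "dist (S v t) (S w t) = exp (- \<kappa> * cl t) * norm (interp N (G (Volterra (\<lambda>s. unweight v s - unweight w s))) (cl t))"
      unfolding S S0_def dist_norm right_diff_distrib[symmetric] lin[OF cl] by (simp add: norm_mult)
    ultimately have "dist (S v t) (S w t) \<le> exp (- \<kappa> * cl t) * (dist v w / 2 * exp (\<kappa> * cl t))"
      by simp
    also have "\<dots> = 1 / 2 * dist v w" by (simp add: exp_minus)
    finally show "dist (S v t) (S w t) \<le> 1 / 2 * dist v w" .
  qed
  then have "\<exists>!v. S v = v" by (intro banach_fix_type[of "1 / 2"]) auto
  then obtain v where v: "S v = v" by blast
  have "unweight v t = interp N (G (Y v)) t" if "t \<in> {0..R}" for t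
  proof -
    have "v t = S0 v t" using S[of v] v by simp
    moreover have "cl t = t" using that by (simp add: cl_def)
    ultimately have "unweight v t = of_real (exp (\<kappa> * t)) * (of_real (exp (- \<kappa> * t)) * interp N (G (Y v)) t)"
      by (simp add: unweight_def S0_def)
    also have "\<dots> = of_real (exp (\<kappa> * t) * exp (- \<kappa> * t)) * interp N (G (Y v)) t" by (simp only: of_real_mult mult.assoc)
    also have "exp (\<kappa> * t) * exp (- \<kappa> * t) = 1" by (simp flip: exp_add)
    finally show ?thesis by simp
  qed
  then show ?thesis
    using collocation_of_fixed_point[OF N \<phi> u_cont, of v] unfolding Y_def by blast
qed

lemma collocation_error:
  assumes "contracts \<kappa> N" "0 < \<kappa>" and N: "1 \<le> N"
    and y: "ivp_solution \<tau> R a b c \<phi> y"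
    and q: "collocation_solution \<tau> R a b c N (cheb_node R N) \<phi> q"
  shows "max_norm (-\<tau>) R (\<lambda>t. y t - q t)
      \<le> R * (2 * exp (\<kappa> * R)) * max_norm 0 R (interp_residual R N (cheb_node R N) y)"
    and "max_norm 0 R (\<lambda>t. deriv_plus R y t - deriv_plus R q t)
      \<le> 2 * exp (\<kappa> * R) * max_norm 0 R (interp_residual R N (cheb_node R N) y)"
proof -
  let ?D = "max_norm 0 R (interp_residual R N (cheb_node R N) y)"
  have y_cont: "continuous_on {-\<tau>..R} y" and init: "\<And>\<theta>. \<theta> \<in> {-\<tau>..0} \<Longrightarrow> y \<theta> = \<phi> \<theta>"
    and der: "\<And>t. t \<in> {0..R} \<Longrightarrow> (y has_vector_derivative G y t) (at t within {0..R})"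
    using y unfolding ivp_solution_def cont_space_def by auto
  have dy: "deriv_plus R y t = G y t" if "t \<in> {0..R}" for t
    by (rule deriv_plus_eq[OF that der[OF that]])
  have "interp N (deriv_plus R y) = interp N (G y)"
    by (rule lagrange_op_cong) (rule dy[OF cheb_node_range[OF R]])
  then have residual: "interp_residual R N (cheb_node R N) y t = G y t - interp N (G y) t" if "t \<in> {0..R}" for t
    using that by (simp add: interp_residual_def dy)
  have "continuous_on {0..R} (\<lambda>t. G y t - interp N (G y) t)"
    by (intro continuous_intros G_continuous y_cont lagrange_op_continuous N)
  then have "continuous_on {0..R} (interp_residual R N (cheb_node R N) y)"
    by (subst continuous_on_cong[OF refl residual])
  then have D: "norm (G y t - interp N (G y) t) \<le> ?D" if "t \<in> {0..R}" for t
    using max_norm_upper[OF _ that] residual[OF that] by metis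
  note stable = collocation_stability[OF assms(1-3) q y_cont init der G_continuous[OF y_cont] D]
  show "max_norm (-\<tau>) R (\<lambda>t. y t - q t) \<le> R * (2 * exp (\<kappa> * R)) * ?D"
    using \<tau> R by (intro max_norm_least stable(2)) auto
  show "max_norm 0 R (\<lambda>t. deriv_plus R y t - deriv_plus R q t) \<le> 2 * exp (\<kappa> * R) * ?D"
    using R stable(1) by (intro max_norm_least) (auto simp: dy)
qed

end

theorem theorem5:
  fixes \<tau> r s :: real
    and a b :: "real \<Rightarrow> complex"
    and c :: "real \<Rightarrow> real \<Rightarrow> complex"
  assumes "\<tau> > 0" and "s \<ge> 0" and "r > s"
    and "continuous_on {0..} a"
    and "continuous_on {0..} b"
    and "continuous_on ({0..} \<times> {-\<tau>..0}) (\<lambda>(t, \<theta>). c t \<theta>)"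
    and "lipschitz_assumption \<tau> (r - s) (shift s a) (shift s b) (shift s c)"
  shows "\<exists>N\<^sub>0\<ge>1. \<exists>C C' :: real. \<forall>N\<ge>N\<^sub>0. \<forall>\<phi> \<in> cont_space (-\<tau>) 0.
    (\<exists>!q. collocation_solution \<tau> (r - s) (shift s a) (shift s b) (shift s c)
             N (cheb_node (r - s) N) \<phi> q) \<and>
    (\<forall>y q. ivp_solution \<tau> (r - s) (shift s a) (shift s b) (shift s c) \<phi> y \<longrightarrow>
       collocation_solution \<tau> (r - s) (shift s a) (shift s b) (shift s c)
             N (cheb_node (r - s) N) \<phi> q \<longrightarrow>
       max_norm (-\<tau>) (r - s) (\<lambda>t. y t - q t)
         \<le> C * max_norm 0 (r - s) (interp_residual (r - s) N (cheb_node (r - s) N) y) \<and>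
       max_norm 0 (r - s) (\<lambda>t. deriv_plus (r - s) y t - deriv_plus (r - s) q t)
         \<le> C' * max_norm 0 (r - s) (interp_residual (r - s) N (cheb_node (r - s) N) y))"
proof -
  interpret delay_equation \<tau> "r - s" "shift s a" "shift s b" "shift s c"
  proof
    show "0 < \<tau>" "0 < r - s" using assms(1,3) by auto
    show "continuous_on {0..r - s} (shift s a)" "continuous_on {0..r - s} (shift s b)"
      unfolding shift_def using assms(2)
      by (auto intro!: continuous_on_compose2[OF assms(4)] continuous_on_compose2[OF assms(5)] continuous_intros)
    have "continuous_on ({0..r - s} \<times> {-\<tau>..0}) (\<lambda>p. (\<lambda>(t, \<theta>). c t \<theta>) (s + fst p, snd p))"
      using assms(2) by (intro continuous_on_compose2[OF assms(6)] continuous_intros) auto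
    then show "continuous_on ({0..r - s} \<times> {-\<tau>..0}) (\<lambda>(t, \<theta>). shift s c t \<theta>)"
      by (simp add: shift_def split_beta)
  qed (rule assms(7))
  obtain \<kappa> N\<^sub>0 where \<kappa>: "0 < \<kappa>" and N\<^sub>0: "1 \<le> N\<^sub>0" and contr: "\<And>N. N\<^sub>0 \<le> N \<Longrightarrow> contracts \<kappa> N"
    using eventually_contracts by metis
  have unique: "\<exists>!q. collocation_solution \<tau> (r - s) (shift s a) (shift s b) (shift s c) N (cheb_node (r - s) N) \<phi> q"
    if "N\<^sub>0 \<le> N" "\<phi> \<in> cont_space (-\<tau>) 0" for N \<phi>
  proof (rule ex_ex1I)
    show "\<exists>q. collocation_solution \<tau> (r - s) (shift s a) (shift s b) (shift s c) N (cheb_node (r - s) N) \<phi> q"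
      using that N\<^sub>0 by (intro collocation_exists[OF contr]) (auto simp: cont_space_def)
  qed (use collocation_unique[OF contr \<kappa>] that N\<^sub>0 in fastforce)
  show ?thesis
    using N\<^sub>0
    by (intro exI[of _ N\<^sub>0] conjI exI[of _ "(r - s) * (2 * exp (\<kappa> * (r - s)))"] exI[of _ "2 * exp (\<kappa> * (r - s))"]
        allI impI ballI unique collocation_error[OF contr \<kappa>]) auto
qed

end
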